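(* Let $1\le p<\infty$. Let $K:\mathbb R^n\times\mathbb R^n\to\mathbb R$ be a kernel satisfying the size condition $|K(x,y)|\le C_0|x-y|^{-n}$ for some constant $C_0$, and let $Q:\mathbb R^n\times\mathbb R^n\to\mathbb R$ be a bounded function. Assume that there exist constants $c,M>0$ and $0<s<1$ such that for every $z=\alpha+it\in\mathbb C$ (with $\alpha,t\in\mathbb R$) $$\sup_{|x-y|<1}\left|K(x,y)\left(e^{zQ(x,y)}-A(z,x)\right)\right|\le M^{|\alpha|}e^{c|t|^s}<\infty,$$ for some function $A$ such that $A(\cdot,x)$ is analytic for each $x$ and $|A(z,x)|\le M^{|\alpha|}$. Assume also that there exist $c'>0$ and $C_1>0$ such that for every $t\in\mathbb R$ the operator $T_{K,tQ}$ is bounded on $L^p(\mathbb R^n)$ with $$\|T_{K,tQ}\|_{L^p\to L^p}\le C_1e^{c'|t|^s}.$$ Then there exists $D>0$ such that, for every integer $k\ge1$, the operator $H_{KQ^k}$ is bounded from $L^p(\mathbb R^n)$ to $L^p(\mathbb R^n)$ with norm less than or equal to $D^k$.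
   Context: For real functions $K,Q$ on $\mathbb R^n\times\mathbb R^n$, and $f$ in a space of test functions, the operators are defined (integrals in the principal value sense) by $$T_{K,Q}f(x)=\mathrm{p.v.}\int_{\mathbb R^n}K(x,y)e^{iQ(x,y)}f(y)\,dy,\qquad H_{KQ^k}f(x)=\mathrm{p.v.}\int_{\mathbb R^n}K(x,y)Q(x,y)^kf(y)\,dy.$$ Thus $T_{K,tQ}$ has phase $tQ$. *)

theory Defs
  imports "HOL-Analysis.Analysis"
begin

text \<open>
  \<open>C_k_fun k f\<close>: \<open>f\<close> is \<open>k\<close> times continuously differentiable on the whole space (in the real
  sense). The recursion goes through directional derivatives so that the type does not change.
\<close>

primrec C_k_fun :: "nat \<Rightarrow> ('a::euclidean_space \<Rightarrow> 'b::real_normed_vector) \<Rightarrow> bool" where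
  "C_k_fun 0 f \<longleftrightarrow> continuous_on UNIV f"
| "C_k_fun (Suc k) f \<longleftrightarrow>
     (\<forall>x. f differentiable (at x)) \<and> (\<forall>v. C_k_fun k (\<lambda>x. frechet_derivative f (at x) v))"

definition test_function :: "('a::euclidean_space \<Rightarrow> complex) \<Rightarrow> bool" where
  "test_function f \<longleftrightarrow> (\<forall>k. C_k_fun k f) \<and> compact (closure {x. f x \<noteq> 0})"

definition Lp_fun :: "real \<Rightarrow> ('a::euclidean_space \<Rightarrow> complex) \<Rightarrow> bool" where
  "Lp_fun p f \<longleftrightarrow> f \<in> borel_measurable lebesgue \<and> integrable lebesgue (\<lambda>x. cmod (f x) powr p)"

definition Lp_norm :: "real \<Rightarrow> ('a::euclidean_space \<Rightarrow> complex) \<Rightarrow> real" where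
  "Lp_norm p f = (LINT x|lebesgue. cmod (f x) powr p) powr (1 / p)"

definition truncated_op ::
  "('a::euclidean_space \<times> 'a \<Rightarrow> complex) \<Rightarrow> real \<Rightarrow> ('a \<Rightarrow> complex) \<Rightarrow> 'a \<Rightarrow> complex" where
  "truncated_op k \<epsilon> f x = (LINT y:{y. dist x y > \<epsilon>}|lebesgue. k (x, y) * f y)"

definition pv_exists ::
  "('a::euclidean_space \<times> 'a \<Rightarrow> complex) \<Rightarrow> ('a \<Rightarrow> complex) \<Rightarrow> 'a \<Rightarrow> bool" where
  "pv_exists k f x \<longleftrightarrow> (\<exists>L. ((\<lambda>\<epsilon>. truncated_op k \<epsilon> f x) \<longlongrightarrow> L) (at_right 0))"

text \<open>The principal value operator with kernel \<open>k\<close>; meaningful at \<open>x\<close> only if \<open>pv_exists k f x\<close>.\<close>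

definition pv_op ::
  "('a::euclidean_space \<times> 'a \<Rightarrow> complex) \<Rightarrow> ('a \<Rightarrow> complex) \<Rightarrow> 'a \<Rightarrow> complex" where
  "pv_op k f x = Lim (at_right 0) (\<lambda>\<epsilon>. truncated_op k \<epsilon> f x)"

text \<open>
  The operator with kernel \<open>k\<close>, defined on test functions, is bounded on \<open>L\<^sup>p\<close> with norm at
  most \<open>C\<close>. The principal values are required to exist almost everywhere. As test functions are
  dense in \<open>L\<^sup>p\<close> for finite \<open>p\<close>, the estimate on them is what determines the bounded extension
  and its norm.
\<close>

definition pv_op_bounded :: "real \<Rightarrow> ('a::euclidean_space \<times> 'a \<Rightarrow> complex) \<Rightarrow> real \<Rightarrow> bool" where
  "pv_op_bounded p k C \<longleftrightarrow>
     (\<forall>f. test_function f \<longrightarrow>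
        (AE x in lebesgue. pv_exists k f x) \<and>
        Lp_fun p (pv_op k f) \<and>
        Lp_norm p (pv_op k f) \<le> C * Lp_norm p f)"

text \<open>The kernels of the operators \<open>T\<^bsub>K,Q\<^esub>\<close> and \<open>H\<^bsub>KQ^k\<^esub>\<close>.\<close>

definition T_kernel :: "('a \<times> 'a \<Rightarrow> real) \<Rightarrow> ('a \<times> 'a \<Rightarrow> real) \<Rightarrow> 'a \<times> 'a \<Rightarrow> complex" where
  "T_kernel K Q w = of_real (K w) * exp (\<i> * of_real (Q w))"

definition H_kernel :: "('a \<times> 'a \<Rightarrow> real) \<Rightarrow> ('a \<times> 'a \<Rightarrow> real) \<Rightarrow> nat \<Rightarrow> 'a \<times> 'a \<Rightarrow> complex" where
  "H_kernel K Q k w = of_real (K w * Q w ^ k)"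

end

theory Submission
  imports Defs
begin

text \<open>
  The values of \<open>Q\<close> lie in an interval \<open>[-B, B]\<close>, and on this interval
  \<open>u = \<Sum>n. a n * exp (\<i> * \<tau> n * u)\<close> with coefficients so small that
  \<open>D = \<Sum>n. |a n| * exp (c * |\<tau> n| powr s)\<close> is finite. Such an expansion exists because \<open>s < 1\<close>:
  smooth a triangle wave by infinitely many averages over shorter and shorter intervals, so that it
  stays linear near \<open>0\<close> while its Fourier coefficients get multiplied by a product of sinc factors.
  Substituting \<open>u = Q\<close> writes the operator with kernel \<open>K * Q ^ Suc k * exp (\<i> * t * Q)\<close> as
  the sum of \<open>a n\<close> times the operators with kernel \<open>K * Q ^ k * exp (\<i> * (t + \<tau> n) * Q)\<close>.
  As the weight \<open>exp (c * |t| powr s)\<close> is submultiplicative in \<open>t\<close>, each power of \<open>Q\<close> costs a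
  factor \<open>D\<close>. The near-diagonal hypothesis, used for imaginary \<open>z\<close> only, dominates the truncations
  uniformly, which allows the principal value limit to be taken inside the sum.
\<close>

subsection \<open>A rapidly convergent exponential series for the identity near the origin\<close>

lemma cos_ge_half:
  fixes v :: real
  assumes "\<bar>v\<bar> \<le> 1"
  shows "1/2 \<le> cos v"
proof -
  have "cos (pi/3) \<le> cos \<bar>v\<bar>"
    using assms pi_gt3 by (intro cos_monotone_0_pi_le) auto
  then show ?thesis by (simp add: cos_60 abs_if split: if_splits)
qed

text \<open>The product formula turns \<open>2 * cos v * sin ((2*k+1) * v)\<close> into
  \<open>sin ((2*k+2) * v) + sin (2*k * v)\<close>, so the alternating sum telescopes.\<close>

lemma sum_alternating_sin_odd:
  fixes v :: real
  shows "2 * cos v * (\<Sum>k<N. (-1)^k * sin (real (2*k+1) * v)) = - ((-1)^N * sin (2 * real N * v))"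
proof (induction N)
  case (Suc N)
  have 1: "sin (2 * real (Suc N) * v) = sin (real (2*N+1) * v + v)"
    "sin (2 * real N * v) = sin (real (2*N+1) * v - v)"
    by (auto simp: algebra_simps)
  have "sin (2 * real (Suc N) * v) + sin (2 * real N * v) = 2 * cos v * sin (real (2*N+1) * v)"
    unfolding 1 by (simp only: sin_add sin_diff) simp
  then have 2: "2 * cos v * ((-1)^N * sin (real (2*N+1) * v))
      = (-1)^N * (sin (2 * real (Suc N) * v) + sin (2 * real N * v))"
    by (simp only: mult_ac)
  show ?case
    unfolding sum.lessThan_Suc distrib_left[of "2 * cos v"] Suc 2 by (simp add: algebra_simps)
qed simp

text \<open>By the closed form above, the derivative of the cosine sum is
  \<open>sin (2 * N * v) / (2 * cos v)\<close> up to sign. It is not small, but it oscillates with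
  frequency \<open>2 * N\<close> while \<open>cos v\<close> stays at least 1/2, so one integration
  by parts makes its integral from 0 of order \<open>1 / N\<close>.\<close>

lemma cos_odd_partial_sums_near_constant:
  fixes v :: real
  assumes v: "\<bar>v\<bar> \<le> 1" and N: "N > 0"
  shows "\<bar>(\<Sum>k<N. (-1)^k / real (2*k+1) * cos (real (2*k+1) * v)) - (\<Sum>k<N. (-1)^k / real (2*k+1))\<bar>
    \<le> 2 / real N"
proof -
  define F where "F v = (\<Sum>k<N. (-1)^k / real (2*k+1) * cos (real (2*k+1) * v))" for v :: real
  \<comment> \<open>\<open>R\<close> is minus the boundary term of the integration by parts. Adding
    it to \<open>F\<close> cancels the oscillating part of the derivative; what remains is
    \<open>R'\<close>, which is thus the derivative of \<open>F + R\<close> and not of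
    \<open>R\<close>.\<close>
  define R where "R v = (-1)^N * cos (2 * real N * v) / (4 * real N * cos v)" for v :: real
  define R' where "R' v = (-1)^N * cos (2 * real N * v) * sin v / (4 * real N * (cos v)^2)" for v :: real
  have deriv: "((\<lambda>v. F v + R v) has_field_derivative R' v) (at v within {-1..1})"
    if "v \<in> {-1..1}" for v
  proof -
    have c: "cos v \<noteq> 0" using cos_ge_half[of v] that by (force simp: abs_le_iff)
    let ?D = "\<Sum>k<N. (-1)^k * sin (real (2*k+1) * v)"
    have D: "?D = - ((-1)^N * sin (2 * real N * v)) / (2 * cos v)"
      using sum_alternating_sin_odd[of v N] c by (simp add: field_simps)
    have "(F has_field_derivative (\<Sum>k<N. - ((-1)^k * sin (real (2*k+1) * v)))) (at v within {-1..1})"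
      unfolding F_def by (rule derivative_eq_intros sum.cong refl | simp)+
    moreover have "(\<Sum>k<N. - ((-1)^k * sin (real (2*k+1) * v))) = (-1)^N * sin (2 * real N * v) / (2 * cos v)"
      using D by (simp add: sum_negf)
    moreover have "(R has_field_derivative
       (R' v - (-1)^N * sin (2 * real N * v) / (2 * cos v))) (at v within {-1..1})"
      unfolding R_def R'_def using c N
      by (auto intro!: derivative_eq_intros simp: field_simps power2_eq_square)
    ultimately show ?thesis
      by (auto intro!: derivative_eq_intros)
  qed
  have bnd: "norm (R' v) \<le> 1 / real N" if "v \<in> {-1..1}" for v
  proof -
    have c: "1/2 \<le> cos v" using that by (intro cos_ge_half) auto
    then have "1/4 \<le> (cos v)^2" using mult_mono[OF c c] by (simp add: power2_eq_square)
    then have "real N \<le> 4 * real N * (cos v)^2" using N by simp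
    moreover have "\<bar>cos (2 * real N * v) * sin v\<bar> \<le> 1"
      unfolding abs_mult by (rule mult_le_one) auto
    ultimately show ?thesis
      using N unfolding R'_def by (simp add: abs_mult) (intro frac_le; auto)
  qed
  have R: "\<bar>R v\<bar> \<le> 1 / (2 * real N)" if "v \<in> {-1..1}" for v
  proof -
    have c: "1/2 \<le> cos v" using that by (intro cos_ge_half) auto
    then have "2 * real N \<le> 4 * real N * cos v" using N by simp
    then show ?thesis
      using c N unfolding R_def by (simp add: abs_mult) (intro frac_le; auto)
  qed
  have "norm ((F v + R v) - (F 0 + R 0)) \<le> 1 / real N * norm (v - 0)"
    by (rule field_differentiable_bound[of "{-1..1}"]) (use deriv bnd v in auto)
  also have "\<dots> \<le> 1 / real N * 1"
    using v by (intro mult_left_mono) auto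
  finally have "\<bar>(F v + R v) - (F 0 + R 0)\<bar> \<le> 1 / real N" by simp
  moreover have "\<bar>R v\<bar> \<le> 1 / (2 * real N)" "\<bar>R 0\<bar> \<le> 1 / (2 * real N)"
    using R[of v] R[of 0] v by (auto simp: abs_le_iff)
  moreover have "1 / (2 * real N) + 1 / (2 * real N) + 1 / real N = 2 / real N"
    by (simp add: field_simps)
  ultimately have "\<bar>F v - F 0\<bar> \<le> 2 / real N" by linarith
  then show ?thesis by (simp add: F_def)
qed

text \<open>The sine partial sum has the cosine partial sum of the previous lemma as its derivative.
  That one is within \<open>2 / N\<close> of the partial sum \<open>c N\<close> of the Leibniz
  series, so integrating from 0 gives \<open>c N * u\<close> up to \<open>2 / N\<close>, and
  \<open>c N\<close> tends to \<open>pi / 4\<close>.\<close>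

lemma triangle_wave_sums:
  fixes u :: real
  assumes u: "\<bar>u\<bar> \<le> 1"
  shows "(\<lambda>k. (-1)^k / (real (2*k+1))^2 * sin (real (2*k+1) * u)) sums (pi / 4 * u)"
proof -
  define F where "F N v = (\<Sum>k<N. (-1)^k / (real (2*k+1))^2 * sin (real (2*k+1) * v))" for N and v :: real
  define c where "c N = (\<Sum>k<N. (-1)^k / real (2*k+1))" for N :: nat
  have "summable (\<lambda>k. (-1)^k * 1 / real (k * 2 + 1))"
    using summable_arctan_series[of 1] by simp
  then have "(\<lambda>k. (-1)^k * 1 / real (k * 2 + 1)) sums (pi / 4)"
    unfolding pi_series by (rule summable_sums)
  then have c: "c \<longlonglongrightarrow> pi / 4"
    by (simp add: sums_def c_def[abs_def] mult.commute)
  have bd: "norm (F N u - c N * u) \<le> 2 / real N" if N: "N > 0" for N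
  proof -
    define F' where "F' v = (\<Sum>k<N. (-1)^k / real (2*k+1) * cos (real (2*k+1) * v))" for v :: real
    have "((\<lambda>v. F N v - c N * v) has_field_derivative (F' v - c N)) (at v within {-1..1})" for v
    proof -
      have "(F N has_field_derivative F' v) (at v within {-1..1})"
        unfolding F_def F'_def
        by (rule derivative_eq_intros sum.cong refl | simp add: power2_eq_square)+
      then show ?thesis by (auto intro!: derivative_eq_intros)
    qed
    moreover have "norm (F' v - c N) \<le> 2 / real N" if "v \<in> {-1..1}" for v
      using cos_odd_partial_sums_near_constant[of v N] that N
      by (simp add: F'_def c_def abs_le_iff)
    ultimately have "norm ((F N u - c N * u) - (F N 0 - c N * 0)) \<le> 2 / real N * norm (u - 0)"
      by (intro field_differentiable_bound[of "{-1..1}"]) (use u in auto)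
    also have "\<dots> \<le> 2 / real N * 1" using u by (intro mult_left_mono) auto
    finally show ?thesis by (simp add: F_def)
  qed
  have "(\<lambda>N. F N u - c N * u) \<longlonglongrightarrow> 0"
  proof (rule Lim_null_comparison)
    show "eventually (\<lambda>N. norm (F N u - c N * u) \<le> 2 / real N) sequentially"
      using eventually_gt_at_top[of 0] by eventually_elim (rule bd)
    show "(\<lambda>N. 2 / real N) \<longlonglongrightarrow> 0"
      by (rule lim_const_over_n)
  qed
  from tendsto_add[OF this tendsto_mult[OF c tendsto_const[of u]]]
  show ?thesis by (simp add: sums_def F_def)
qed

section \<open>Smoothing by averages over intervals\<close>

text \<open>Averaging over \<open>[u - a, u + a]\<close> fixes linear functions and multiplies
  \<open>sin (m * u)\<close> by \<open>sin (m * a) / (m * a)\<close>. The price is that the radius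
  of the interval of validity shrinks by \<open>a\<close>.\<close>

lemma sinc_average_sums:
  fixes b m :: "nat \<Rightarrow> real" and \<gamma> R a u :: real
  assumes b: "summable (\<lambda>k. \<bar>b k\<bar>)" and m: "\<And>k. m k \<ge> 1" and a: "a > 0"
    and f: "\<And>v. \<bar>v\<bar> \<le> R \<Longrightarrow> (\<lambda>k. b k * sin (m k * v)) sums (\<gamma> * v)"
    and u: "\<bar>u\<bar> \<le> R - a"
  shows "(\<lambda>k. (b k * (sin (m k * a) / (m k * a))) * sin (m k * u)) sums (\<gamma> * u)"
proof -
  define g where "g k v = - (b k / m k * cos (m k * v))" for k v
  have m0: "m k > 0" for k using m[of k] by linarith
  have le: "\<bar>b k / m k\<bar> \<le> \<bar>b k\<bar>" for k
    using m[of k] divide_left_mono[of 1 "m k" "\<bar>b k\<bar>"] m0[of k] by simp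
  have gs: "summable (\<lambda>k. g k v)" for v
  proof (rule summable_comparison_test'[OF b])
    fix k show "norm (g k v) \<le> \<bar>b k\<bar>"
      using mult_mono[OF le[of k] abs_cos_le_one[of "m k * v"]]
      by (simp add: g_def abs_mult)
  qed
  have unif: "uniformly_convergent_on UNIV (\<lambda>n x. \<Sum>k<n. b k * sin (m k * x))"
    by (rule Weierstrass_m_test'[OF _ b]) (simp add: abs_mult mult_left_le[OF abs_sin_le_one])
  have dg: "(g k has_field_derivative b k * sin (m k * v)) (at v within UNIV)" for k v
    unfolding g_def using m0[of k] by (auto intro!: derivative_eq_intros)
  have G: "((\<lambda>x. \<Sum>k. g k x) has_field_derivative (\<Sum>k. b k * sin (m k * v))) (at v)" for v
    by (rule has_field_derivative_series'(2)[OF convex_UNIV dg unif UNIV_I gs[of 0]]) auto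
  \<comment> \<open>The average is computed through antiderivatives: \<open>g k\<close> integrates
    the k-th term, and on \<open>[-R, R]\<close> the sum of the \<open>g k\<close> differs from the
    primitive \<open>\<gamma> * v^2 / 2\<close> by a constant, which drops out of the difference
    between \<open>u + a\<close> and \<open>u - a\<close>.\<close>
  define H where "H v = (\<Sum>k. g k v) - \<gamma> * v^2 / 2" for v
  have "H (u + a) = H (u - a)"
  proof -
    have "\<exists>c. \<forall>x\<in>{-R..R}. H x = c"
    proof (rule has_field_derivative_zero_constant)
      show "(H has_field_derivative 0) (at x within {-R..R})" if "x \<in> {-R..R}" for x
      proof -
        have "(\<Sum>k. b k * sin (m k * x)) = \<gamma> * x"
          using f[of x] that by (auto simp: sums_iff)
        then have "(H has_field_derivative 0) (at x)"
          unfolding H_def using G[of x] by (auto intro!: derivative_eq_intros)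
        then show ?thesis by (rule has_field_derivative_at_within)
      qed
    qed auto
    then show ?thesis using u a by (smt (verit) atLeastAtMost_iff)
  qed
  then have eq: "(\<Sum>k. g k (u + a)) - (\<Sum>k. g k (u - a)) = 2 * a * (\<gamma> * u)"
    unfolding H_def by (simp add: power2_eq_square field_simps)
  have "(\<lambda>k. g k (u + a) - g k (u - a)) sums ((\<Sum>k. g k (u + a)) - (\<Sum>k. g k (u - a)))"
    by (intro sums_diff summable_sums gs)
  then have "(\<lambda>k. (g k (u + a) - g k (u - a)) / (2 * a)) sums (2 * a * (\<gamma> * u) / (2 * a))"
    unfolding eq by (rule sums_divide)
  moreover have "(g k (u + a) - g k (u - a)) / (2 * a)
      = (b k * (sin (m k * a) / (m k * a))) * sin (m k * u)" for k
    unfolding g_def using a m0[of k]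
    by (simp add: cos_add cos_diff field_simps)
  ultimately show ?thesis using a by simp
qed

lemma sinc_square_bounds:
  fixes x :: real
  shows "0 \<le> (sin x / x)^2" "(sin x / x)^2 \<le> 1"
proof -
  have "\<bar>sin x\<bar> / \<bar>x\<bar> \<le> 1"
    using abs_sin_x_le_abs_x[of x] by (cases "x = 0") auto
  then show "(sin x / x)^2 \<le> 1"
    by (metis abs_divide abs_square_le_1)
qed simp

text \<open>Each half-width is used twice in succession. The resulting factors are squares, hence
  nonnegative and at most 1, so that the products decrease in \<open>J\<close> and a limit is
  available later; the radius drops by \<open>2 * a j\<close> per step.\<close>

lemma iterated_sinc_average_sums:
  fixes b m a :: "nat \<Rightarrow> real" and \<gamma> R u :: real
  assumes b: "summable (\<lambda>k. \<bar>b k\<bar>)" and m: "\<And>k. m k \<ge> 1" and a: "\<And>j. a j > 0"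
    and f: "\<And>v. \<bar>v\<bar> \<le> R \<Longrightarrow> (\<lambda>k. b k * sin (m k * v)) sums (\<gamma> * v)"
    and u: "\<bar>u\<bar> \<le> R - 2 * (\<Sum>j<J. a j)"
  shows "(\<lambda>k. b k * (\<Prod>j<J. (sin (m k * a j) / (m k * a j))^2) * sin (m k * u)) sums (\<gamma> * u)"
  using u
proof (induction J arbitrary: u)
  case 0
  then show ?case using f by simp
next
  case (Suc J)
  define P where "P k = (\<Prod>j<J. (sin (m k * a j) / (m k * a j))^2)" for k
  define S where "S k = sin (m k * a J) / (m k * a J)" for k
  define R' where "R' = R - 2 * (\<Sum>j<J. a j)"
  have P: "\<bar>P k\<bar> \<le> 1" for k
    unfolding P_def abs_prod by (intro prod_le_1) (use sinc_square_bounds in auto)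
  have S: "\<bar>S k\<bar> \<le> 1" for k
    using sinc_square_bounds(2) abs_square_le_1 unfolding S_def by blast
  have 1: "summable (\<lambda>k. \<bar>b k * P k\<bar>)"
    by (rule summable_comparison_test'[OF b]) (simp add: abs_mult mult_left_le P)
  have 2: "summable (\<lambda>k. \<bar>b k * P k * S k\<bar>)"
    by (rule summable_comparison_test'[OF 1]) (simp add: abs_mult mult_left_le S)
  have "(\<lambda>k. b k * P k * sin (m k * v)) sums (\<gamma> * v)" if "\<bar>v\<bar> \<le> R'" for v
    using Suc.IH[of v] that by (simp add: P_def R'_def)
  from sinc_average_sums[OF 1 m a[of J] this]
  have "(\<lambda>k. b k * P k * S k * sin (m k * v)) sums (\<gamma> * v)" if "\<bar>v\<bar> \<le> R' - a J" for v
    using that unfolding S_def by blast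
  from sinc_average_sums[OF 2 m a[of J] this]
  have "(\<lambda>k. b k * P k * S k * S k * sin (m k * v)) sums (\<gamma> * v)" if "\<bar>v\<bar> \<le> R' - a J - a J" for v
    using that unfolding S_def by blast
  moreover have "\<bar>u\<bar> \<le> R' - a J - a J"
    using Suc.prems by (simp add: R'_def)
  ultimately show ?case
    by (simp add: P_def S_def power2_eq_square mult.assoc)
qed

section \<open>Decay of sinc products against stretched exponentials\<close>

lemma powr_diff_bounded_above:
  fixes c \<kappa> s \<sigma> :: real
  assumes "0 \<le> c" "0 < \<kappa>" "0 < s" "s < \<sigma>"
  obtains C where "\<And>x. 0 < x \<Longrightarrow> c * x powr s - \<kappa> * x powr \<sigma> \<le> C"
proof
  fix x :: real assume x: "0 < x"
  \<comment> \<open>\<open>y\<close> is the point where the two terms balance: up to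
    \<open>y\<close> the first term is at most its value there, and beyond \<open>y\<close> the
    difference is at most 0.\<close>
  define y where "y = (c / \<kappa>) powr (1 / (\<sigma> - s))"
  show "c * x powr s - \<kappa> * x powr \<sigma> \<le> c * y powr s"
  proof (cases "x \<le> y")
    case True
    then have "x powr s \<le> y powr s" using x assms by (intro powr_mono2) auto
    then have "c * x powr s \<le> c * y powr s" using assms by (intro mult_left_mono)
    moreover have "0 \<le> \<kappa> * x powr \<sigma>" using assms by simp
    ultimately show ?thesis by linarith
  next
    case False
    then have "y powr (\<sigma> - s) \<le> x powr (\<sigma> - s)"
      using assms by (intro powr_mono2) (auto simp: y_def)
    then have "c / \<kappa> \<le> x powr (\<sigma> - s)"
      using assms by (simp add: y_def powr_powr)
    then have "c \<le> \<kappa> * x powr (\<sigma> - s)"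
      using assms by (simp add: field_simps)
    then have "c * x powr s \<le> \<kappa> * x powr (\<sigma> - s) * x powr s"
      by (intro mult_right_mono) auto
    also have "\<dots> = \<kappa> * x powr \<sigma>"
      using x by (simp add: mult.assoc powr_add[symmetric])
    finally have "c * x powr s \<le> \<kappa> * x powr \<sigma>" .
    moreover have "0 \<le> c * y powr s" using assms by simp
    ultimately show ?thesis by linarith
  qed
qed

text \<open>Only the factors whose argument is at least 2 are kept. Each of them is at most 1/4,
  hence at most \<open>exp (-1)\<close>, and their number is
  \<open>(\<rho> * m / 2) powr (1/\<beta>)\<close> rounded down; the rounding costs the summand 1 in
  the exponent.\<close>

lemma sinc_product_decay:
  fixes \<rho> \<beta> m :: real
  assumes \<rho>: "0 < \<rho>" and \<beta>: "0 < \<beta>" and m: "0 < m"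
  shows "\<exists>J. (\<Prod>j<J. (sin (m * (\<rho> * real (Suc j) powr -\<beta>)) / (m * (\<rho> * real (Suc j) powr -\<beta>)))^2)
    \<le> exp (1 - (\<rho> * m / 2) powr (1/\<beta>))"
proof -
  define r where "r = (\<rho> * m / 2) powr (1/\<beta>)"
  define J where "J = nat \<lfloor>r\<rfloor>"
  have r0: "r \<ge> 0" by (simp add: r_def)
  have Jr: "real J \<le> r" "r - 1 \<le> real J" using r0 unfolding J_def by linarith+
  have "(\<Prod>j<J. (sin (m * (\<rho> * real (Suc j) powr -\<beta>)) / (m * (\<rho> * real (Suc j) powr -\<beta>)))^2)
      \<le> (\<Prod>j<J. exp (-1))"
  proof (rule prod_mono, safe)
    fix j assume j: "j < J"
    define y where "y = m * (\<rho> * real (Suc j) powr -\<beta>)"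
    have "real (Suc j) powr \<beta> \<le> r powr \<beta>"
      using j Jr \<beta> by (intro powr_mono2) auto
    also have "\<dots> = \<rho> * m / 2"
      using \<rho> m \<beta> by (simp add: r_def powr_powr)
    finally have "2 \<le> y"
      using \<rho> m by (simp add: y_def powr_minus field_simps)
    then have "\<bar>sin y / y\<bar> \<le> 1/2"
      unfolding abs_divide by (intro frac_le) auto
    then have "\<bar>sin y / y\<bar>^2 \<le> (1/2)^2" by (intro power_mono) auto
    also have "\<dots> \<le> exp (-1)"
      using exp_le by (simp add: exp_minus field_simps)
    finally show "(sin y / y)^2 \<le> exp (-1)" by (simp only: power2_abs)
  qed simp
  also have "\<dots> = exp (- real J)" by (simp add: exp_of_nat_mult[symmetric])
  also have "\<dots> \<le> exp (1 - r)" using Jr by simp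
  finally show ?thesis unfolding r_def by blast
qed

section \<open>The weighted expansion of the identity on a given interval\<close>

lemma linear_sine_series:
  fixes B c s :: real
  assumes s: "0 < s" "s < 1" and c: "0 \<le> c"
  obtains a t :: "nat \<Rightarrow> real"
  where "summable (\<lambda>n. \<bar>a n\<bar> * exp (c * \<bar>t n\<bar> powr s))"
    "\<And>u. \<bar>u\<bar> \<le> B \<Longrightarrow> (\<lambda>n. a n * sin (t n * u)) sums u"
proof -
  \<comment> \<open>Two demands compete: the widths \<open>(j+1) powr -\<beta>\<close> must be
    summable, so \<open>\<beta> > 1\<close>, and the decay exponent \<open>1/\<beta>\<close> must
    exceed \<open>s\<close> to beat the weight. The choice makes \<open>1/\<beta>\<close> the
    midpoint of \<open>s\<close> and 1; this is where \<open>s < 1\<close> enters.\<close>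
  define \<beta> where "\<beta> = 2 / (1 + s)"
  have \<beta>: "1 < \<beta>" "s < 1/\<beta>" using s by (auto simp: \<beta>_def field_simps)
  define e where "e j = real (Suc j) powr -\<beta>" for j
  have e_pos: "e j > 0" for j by (simp add: e_def)
  have e: "summable e"
    unfolding e_def summable_Suc_iff[of "\<lambda>j. real j powr -\<beta>"]
    using \<beta> by (simp add: summable_real_powr_iff)
  \<comment> \<open>Normalised so that the half-widths add up to at most 1/4. Each is used twice, so
    of the radius 1 of the triangle wave's linear piece at least 1/2 survives all averages.\<close>
  define \<rho> where "\<rho> = 1 / (4 * suminf e)"
  have sum_e: "0 < suminf e" using e e_pos by (rule suminf_pos)
  have \<rho>: "\<rho> > 0" using sum_e by (simp add: \<rho>_def)
  define w where "w j = \<rho> * e j" for j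
  have w_pos: "w j > 0" for j using \<rho> e_pos by (simp add: w_def)
  have w: "(\<Sum>j<J. w j) \<le> 1/4" for J
  proof -
    have "(\<Sum>j<J. w j) = \<rho> * (\<Sum>j<J. e j)" by (simp add: w_def sum_distrib_left)
    also have "\<dots> \<le> \<rho> * suminf e"
      using \<rho> e e_pos by (intro mult_left_mono sum_le_suminf) (auto intro: less_imp_le)
    finally show ?thesis using sum_e by (simp add: \<rho>_def)
  qed
  define m where "m k = real (2*k+1)" for k
  have m: "m k \<ge> 1" for k by (simp add: m_def)
  define b where "b k = (-1)^k / (m k)^2" for k
  have b: "summable (\<lambda>k. \<bar>b k\<bar>)"
  proof (rule summable_comparison_test')
    show "summable (\<lambda>k. 1 / (real k + 1)^2)"
      using inverse_squares_sums by (simp add: sums_iff add.commute)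
    show "norm \<bar>b k\<bar> \<le> 1 / (real k + 1)^2" for k
      unfolding b_def by (auto simp: abs_mult m_def intro!: divide_left_mono power_mono)
  qed
  have tri: "(\<lambda>k. b k * sin (m k * v)) sums (pi / 4 * v)" if "\<bar>v\<bar> \<le> 1" for v
    using triangle_wave_sums[OF that] by (simp add: b_def m_def)
  define P where "P k J = (\<Prod>j<J. (sin (m k * w j) / (m k * w j))^2)" for k J
  have P: "0 \<le> P k J" "P k J \<le> 1" for k J
    unfolding P_def by (intro prod_nonneg prod_le_1; use sinc_square_bounds in auto)+
  have decP: "decseq (P k)" for k
    by (rule decseq_SucI) (use P sinc_square_bounds in \<open>simp add: P_def mult_left_le\<close>)
  have "\<exists>q. P k \<longlonglongrightarrow> q \<and> (\<forall>J. q \<le> P k J)" for k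
    using decseq_convergent[OF decP[of k]] P(1) by metis
  then obtain q where q: "\<And>k. P k \<longlonglongrightarrow> q k" "\<And>k J. q k \<le> P k J" by metis
  have q0: "0 \<le> q k" for k using LIMSEQ_le_const[OF q(1)] P(1) by blast
  have qs: "(\<lambda>k. b k * q k * sin (m k * u)) sums (pi / 4 * u)" if u: "\<bar>u\<bar> \<le> 1/2" for u
  proof -
    have bnd: "norm (b k * P k J * sin (m k * u)) \<le> \<bar>b k\<bar>" for k J
    proof -
      have "\<bar>b k\<bar> * (P k J * \<bar>sin (m k * u)\<bar>) \<le> \<bar>b k\<bar> * 1"
        using P[of k J] by (intro mult_left_mono mult_le_one) auto
      then show ?thesis using P[of k J] by (simp add: abs_mult mult.assoc)
    qed
    \<comment> \<open>Tannery's theorem with the majorant \<open>\<bar>b k\<bar>\<close> lets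
      \<open>J\<close> tend to infinity inside the series. For every finite \<open>J\<close> the sum
      is already \<open>pi / 4 * u\<close>, so the limit has the same value.\<close>
    have T: "eventually (\<lambda>J. summable (\<lambda>k. norm (b k * P k J * sin (m k * u)))) sequentially \<and>
        summable (\<lambda>k. norm (b k * q k * sin (m k * u))) \<and>
        (\<lambda>J. \<Sum>k. b k * P k J * sin (m k * u)) \<longlonglongrightarrow> (\<Sum>k. b k * q k * sin (m k * u))"
    proof (rule tannerys_theorem[OF _ _ b])
      show "(\<lambda>J. b k * P k J * sin (m k * u)) \<longlonglongrightarrow> b k * q k * sin (m k * u)" for k
        by (intro tendsto_mult tendsto_const q(1))
      show "eventually (\<lambda>(k, J). norm (b k * P k J * sin (m k * u)) \<le> \<bar>b k\<bar>) (at_top \<times>\<^sub>F sequentially)"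
        by (rule always_eventually) (use bnd in blast)
    qed simp
    have "(\<Sum>k. b k * P k J * sin (m k * u)) = pi / 4 * u" for J
    proof -
      have "\<bar>u\<bar> \<le> 1 - 2 * (\<Sum>j<J. w j)" using u w[of J] by linarith
      from iterated_sinc_average_sums[OF b m w_pos tri this] show ?thesis
        unfolding P_def by (simp add: sums_iff)
    qed
    then have "(\<lambda>J. pi / 4 * u) \<longlonglongrightarrow> (\<Sum>k. b k * q k * sin (m k * u))"
      using T by presburger
    then have "(\<Sum>k. b k * q k * sin (m k * u)) = pi / 4 * u"
      using LIMSEQ_const_iff by metis
    moreover have "summable (\<lambda>k. b k * q k * sin (m k * u))"
      using T by (rule summable_norm_cancel[OF conjunct1[OF conjunct2]])
    ultimately show ?thesis by (simp add: sums_iff)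
  qed
  \<comment> \<open>Rescales \<open>[-B, B]\<close> into \<open>[-1/2, 1/2]\<close>; the summand 1
    keeps the denominator positive for every \<open>B\<close>.\<close>
  define \<tau> where "\<tau> = 1 / (2 * (\<bar>B\<bar> + 1))"
  have \<tau>: "0 < \<tau>" by (simp add: \<tau>_def)
  define \<kappa> where "\<kappa> = (\<rho> / 2) powr (1/\<beta>)"
  obtain C where C: "\<And>x. 0 < x \<Longrightarrow> (c * \<tau> powr s) * x powr s - \<kappa> * x powr (1/\<beta>) \<le> C"
    using powr_diff_bounded_above[of "c * \<tau> powr s" \<kappa> s "1/\<beta>"] c s \<beta> \<rho> \<tau> by (auto simp: \<kappa>_def)
  have qbound: "q k * exp (c * \<bar>\<tau> * m k\<bar> powr s) \<le> exp (1 + C)" for k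
  proof -
    have mk: "0 < m k" using m[of k] by linarith
    from sinc_product_decay[of \<rho> \<beta> "m k"]
    obtain J where "P k J \<le> exp (1 - (\<rho> * m k / 2) powr (1/\<beta>))"
      using \<rho> \<beta> mk unfolding P_def w_def e_def by auto
    then have "q k \<le> exp (1 - (\<rho> * m k / 2) powr (1/\<beta>))" using q(2)[of k J] by linarith
    also have "(\<rho> * m k / 2) powr (1/\<beta>) = \<kappa> * m k powr (1/\<beta>)"
      using \<rho> mk by (simp add: \<kappa>_def powr_mult[symmetric])
    finally have "q k \<le> exp (1 - \<kappa> * m k powr (1/\<beta>))" .
    then have "q k * exp (c * \<bar>\<tau> * m k\<bar> powr s)
        \<le> exp (1 - \<kappa> * m k powr (1/\<beta>)) * exp (c * \<bar>\<tau> * m k\<bar> powr s)"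
      by (intro mult_right_mono) auto
    also have "\<dots> = exp (1 + ((c * \<tau> powr s) * m k powr s - \<kappa> * m k powr (1/\<beta>)))"
      using \<tau> mk by (simp add: exp_add[symmetric] powr_mult algebra_simps)
    also have "\<dots> \<le> exp (1 + C)" using C[OF mk] by simp
    finally show ?thesis .
  qed
  show ?thesis
  proof
    \<comment> \<open>The factor \<open>4 / (pi * \<tau>)\<close> undoes the slope
      \<open>pi / 4\<close> and the rescaling. By \<open>qbound\<close> the limit \<open>q n\<close>
      absorbs the exponential weight up to a constant, and \<open>b n\<close> supplies the
      convergence.\<close>
    show "summable (\<lambda>n. \<bar>4 / (pi * \<tau>) * (b n * q n)\<bar> * exp (c * \<bar>\<tau> * m n\<bar> powr s))"
    proof (rule summable_comparison_test')
      show "summable (\<lambda>n. 4 / (pi * \<tau>) * exp (1 + C) * \<bar>b n\<bar>)"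
        by (intro summable_mult b)
      show "norm (\<bar>4 / (pi * \<tau>) * (b n * q n)\<bar> * exp (c * \<bar>\<tau> * m n\<bar> powr s))
          \<le> 4 / (pi * \<tau>) * exp (1 + C) * \<bar>b n\<bar>" for n
      proof -
        have "norm (\<bar>4 / (pi * \<tau>) * (b n * q n)\<bar> * exp (c * \<bar>\<tau> * m n\<bar> powr s))
          = (4 / (pi * \<tau>) * \<bar>b n\<bar>) * (q n * exp (c * \<bar>\<tau> * m n\<bar> powr s))"
          using q0[of n] \<tau> by (simp add: abs_mult)
        also have "\<dots> \<le> (4 / (pi * \<tau>) * \<bar>b n\<bar>) * exp (1 + C)"
          using \<tau> by (intro mult_left_mono qbound) auto
        finally show ?thesis by (simp add: mult_ac)
      qed
    qed
    show "(\<lambda>n. 4 / (pi * \<tau>) * (b n * q n) * sin (\<tau> * m n * u)) sums u" if u: "\<bar>u\<bar> \<le> B" for u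
    proof -
      have "\<bar>\<tau> * u\<bar> \<le> 1/2" using u \<tau> by (simp add: \<tau>_def abs_mult field_simps)
      from sums_mult[OF qs[OF this], of "4 / (pi * \<tau>)"] show ?thesis
        using \<tau> by (simp add: mult_ac)
    qed
  qed
qed

text \<open>Each sine is split into two exponentials by Euler's formula; the terms with frequency
  \<open>t n\<close> go to the even indices and those with \<open>- t n\<close> to the odd ones. The
  weight depends on the absolute value of the frequency only.\<close>

lemma linear_exp_series:
  fixes B c s :: real
  assumes s: "0 < s" "s < 1" and c: "0 \<le> c"
  obtains a :: "nat \<Rightarrow> complex" and t :: "nat \<Rightarrow> real"
  where "summable (\<lambda>n. cmod (a n) * exp (c * \<bar>t n\<bar> powr s))"
    "\<And>u. \<bar>u\<bar> \<le> B \<Longrightarrow> (\<lambda>n. a n * exp (\<i> * of_real (t n * u))) sums of_real u"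
proof -
  obtain a t :: "nat \<Rightarrow> real"
    where sm: "summable (\<lambda>n. \<bar>a n\<bar> * exp (c * \<bar>t n\<bar> powr s))"
      and su: "\<And>u. \<bar>u\<bar> \<le> B \<Longrightarrow> (\<lambda>n. a n * sin (t n * u)) sums u"
    using linear_sine_series[OF assms, of B] by metis
  define a' where "a' n = (if even n then of_real (a (n div 2)) / (2 * \<i>)
      else - of_real (a ((n - 1) div 2)) / (2 * \<i>))" for n :: nat
  define t' where "t' n = (if even n then t (n div 2) else - t ((n - 1) div 2))" for n :: nat
  let ?f = "\<lambda>n. \<bar>a n\<bar> / 2 * exp (c * \<bar>t n\<bar> powr s)"
  have "summable ?f" using summable_divide[OF sm, of 2] by (simp add: mult.commute)
  then have "summable (\<lambda>n. if even n then ?f (n div 2) else ?f ((n - 1) div 2))"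
    using sums_if[of ?f _ ?f] unfolding summable_def by blast
  also have "(\<lambda>n. if even n then ?f (n div 2) else ?f ((n - 1) div 2)) =
      (\<lambda>n. cmod (a' n) * exp (c * \<bar>t' n\<bar> powr s))"
    by (auto simp: fun_eq_iff a'_def t'_def norm_divide norm_mult)
  finally have 1: "summable (\<lambda>n. cmod (a' n) * exp (c * \<bar>t' n\<bar> powr s))" .
  have "(\<lambda>n. a' n * exp (\<i> * of_real (t' n * u))) sums of_real u" if u: "\<bar>u\<bar> \<le> B" for u
  proof -
    let ?g = "\<lambda>n. a' n * exp (\<i> * of_real (t' n * u))"
    have "summable ?g"
    proof (rule summable_comparison_test'[OF 1])
      show "norm (?g n) \<le> cmod (a' n) * exp (c * \<bar>t' n\<bar> powr s)" for n
        using mult_left_mono[of 1 "exp (c * \<bar>t' n\<bar> powr s)" "cmod (a' n)"] c by (simp add: norm_mult)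
    qed
    then have g: "?g sums suminf ?g" by (rule summable_sums)
    \<comment> \<open>The interleaved series is already known to converge, so its sum may be
      identified along consecutive pairs, each of which is one sine term.\<close>
    have "(\<lambda>n. \<Sum>k\<in>{n*2..<n*2+2}. ?g k) sums suminf ?g"
      by (rule sums_group[OF g]) simp
    moreover have "(\<Sum>k\<in>{n*2..<n*2+2}. ?g k) = of_real (a n * sin (t n * u))" for n
    proof -
      have "{n*2..<n*2+2} = {2*n, 2*n+1}" by auto
      then show ?thesis
        by (simp add: a'_def t'_def sin_of_real[symmetric] sin_exp_eq field_simps)
    qed
    ultimately have "(\<lambda>n. of_real (a n * sin (t n * u))) sums suminf ?g" by simp
    moreover have "(\<lambda>n. complex_of_real (a n * sin (t n * u))) sums of_real u"
      by (rule sums_of_real[OF su[OF u]])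
    ultimately have "suminf ?g = of_real u" by (rule sums_unique2)
    then show ?thesis using g by simp
  qed
  with 1 show ?thesis by (rule that)
qed

subsection \<open>Countable sums in Lebesgue spaces and measurable slices\<close>

lemma powr_above_tangent:
  fixes x m p :: real
  assumes "1 \<le> p" "0 \<le> x" "0 < m"
  shows "m powr p + p * m powr (p - 1) * (x - m) \<le> x powr p"
proof (cases "x = 0")
  case True
  have "m powr (p - 1) * m = m powr p"
    using powr_add[of m "p - 1" 1] assms by simp
  then have "m powr p + p * m powr (p - 1) * (x - m) = (1 - p) * m powr p"
    using True by (simp add: algebra_simps)
  also have "\<dots> \<le> 0" using assms by (simp add: mult_nonpos_nonneg)
  finally show ?thesis using True assms by simp
next
  case False
  have "x powr p - m powr p \<ge> p * m powr (p - 1) * (x - m)"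
  proof (rule convex_on_imp_above_tangent)
    show "convex_on {0<..} (\<lambda>x. x powr p)" by (rule powr_convex) fact
    show "((\<lambda>x. x powr p) has_real_derivative p * m powr (p - 1)) (at m within {0<..})"
      using assms by (auto intro!: derivative_eq_intros)
  qed (use assms False in \<open>auto simp: interior_open\<close>)
  then show ?thesis by simp
qed

text \<open>Jensen's inequality for weights of total mass at most 1: sum the tangent inequality at
  the weighted sum \<open>m\<close>. The missing mass contributes
  \<open>(1 - sum w I) * (p - 1) * m powr p\<close>, which is nonnegative.\<close>

lemma powr_weighted_sum_le:
  fixes w y :: "'i \<Rightarrow> real"
  assumes p: "1 \<le> p" and w: "\<And>i. i \<in> I \<Longrightarrow> 0 \<le> w i" "sum w I \<le> 1"
    and y: "\<And>i. i \<in> I \<Longrightarrow> 0 \<le> y i"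
  shows "(\<Sum>i\<in>I. w i * y i) powr p \<le> (\<Sum>i\<in>I. w i * y i powr p)"
proof (cases "(\<Sum>i\<in>I. w i * y i) = 0")
  case True
  then show ?thesis using w by (simp add: sum_nonneg)
next
  case False
  define m where "m = (\<Sum>i\<in>I. w i * y i)"
  define d where "d = p * m powr (p - 1)"
  have "m \<ge> 0" unfolding m_def using w y by (intro sum_nonneg) auto
  then have m: "m > 0" using False by (simp add: m_def)
  have d: "d * m = p * m powr p"
    using powr_add[of m "p - 1" 1] m by (simp add: d_def)
  have "0 \<le> (1 - sum w I) * ((p - 1) * m powr p)"
    using w p by (intro mult_nonneg_nonneg) auto
  also have "\<dots> = sum w I * m powr p + d * m - d * m * sum w I - m powr p"
    unfolding d by (simp add: algebra_simps)
  also have "sum w I * m powr p + d * m - d * m * sum w I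
      = (\<Sum>i\<in>I. w i * (m powr p + d * (y i - m)))"
    by (simp add: distrib_left sum.distrib right_diff_distrib sum_subtractf sum_distrib_right[symmetric]
        sum_distrib_left[symmetric] m_def[symmetric] mult.left_commute[of _ d] mult_ac)
  also have "\<dots> \<le> (\<Sum>i\<in>I. w i * y i powr p)"
    unfolding d_def using powr_above_tangent p w y m by (intro sum_mono mult_left_mono) auto
  finally show ?thesis by (simp add: m_def)
qed

lemma Lp_norm_le_iff:
  assumes "1 \<le> p" "0 \<le> c"
  shows "Lp_norm p g \<le> c \<longleftrightarrow> (LINT x|lebesgue. cmod (g x) powr p) \<le> c powr p"
proof -
  define I where "I = (LINT x|lebesgue. cmod (g x) powr p)"
  have I: "I \<ge> 0" unfolding I_def by (intro integral_nonneg_AE) auto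
  have "I powr (1/p) \<le> c \<longleftrightarrow> (I powr (1/p)) powr p \<le> c powr p"
    using assms powr_less_mono2[of p c "I powr (1/p)"] powr_mono2[of p "I powr (1/p)" c]
    by (auto simp: not_less[symmetric])
  then show ?thesis using assms I by (simp add: Lp_norm_def I_def[symmetric] powr_powr)
qed

lemma Lp_norm_nonneg: "0 \<le> Lp_norm p f"
  by (simp add: Lp_norm_def)

text \<open>Countable Minkowski inequality for a series that converges only almost everywhere.
  Jensen is applied pointwise with weights \<open>cmod (a n) * b n / S\<close> to the normalised
  functions \<open>cmod (g n x) / b n\<close>; integrating then bounds the p-th power of the
  sum.\<close>

lemma Lp_sums:
  fixes g :: "nat \<Rightarrow> 'a::euclidean_space \<Rightarrow> complex"
  assumes p: "1 \<le> p" and b: "\<And>n. 0 < b n" and N: "0 \<le> N" and S: "0 < S"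
    and sm: "summable (\<lambda>n. cmod (a n) * b n)" "(\<Sum>n. cmod (a n) * b n) \<le> S"
    and g: "\<And>n. Lp_fun p (g n)" "\<And>n. Lp_norm p (g n) \<le> b n * N"
    and h: "AE x in lebesgue. (\<lambda>n. a n * g n x) sums h x"
  shows "Lp_fun p h" "Lp_norm p h \<le> S * N"
proof -
  have gm[measurable]: "g n \<in> borel_measurable lebesgue" for n
    using g by (simp add: Lp_fun_def)
  have "(\<lambda>x. \<Sum>n. a n * g n x) \<in> borel_measurable lebesgue" by measurable
  moreover have "AE x in lebesgue. (\<Sum>n. a n * g n x) = h x"
    using h by eventually_elim (simp add: sums_iff)
  ultimately have hm[measurable]: "h \<in> borel_measurable lebesgue"
    by (rule borel_measurable_AE)
  define w where "w n = cmod (a n) * b n / S" for n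
  have w0: "0 \<le> w n" for n using b[of n] S by (simp add: w_def)
  have ws: "summable w" unfolding w_def by (intro summable_divide sm)
  have wsum: "suminf w \<le> 1"
    using sm(2) S unfolding w_def by (subst suminf_divide[OF sm(1)]) simp
  define y where "y n x = cmod (g n x) / b n" for n x
  have ym[measurable]: "y n \<in> borel_measurable lebesgue" for n unfolding y_def by measurable
  have pw: "ennreal (cmod (h x) powr p) \<le> ennreal (S powr p) * (\<Sum>n. ennreal (w n * y n x powr p))"
    if x: "(\<lambda>n. a n * g n x) sums h x" for x
  proof (rule LIMSEQ_le_const2)
    show "(\<lambda>m. ennreal (cmod (\<Sum>n<m. a n * g n x) powr p)) \<longlonglongrightarrow> ennreal (cmod (h x) powr p)"
    proof (rule tendsto_ennrealI)
      have "(\<lambda>m. cmod (\<Sum>n<m. a n * g n x)) \<longlonglongrightarrow> cmod (h x)"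
        using x unfolding sums_def by (rule tendsto_norm)
      then show "(\<lambda>m. cmod (\<Sum>n<m. a n * g n x) powr p) \<longlonglongrightarrow> cmod (h x) powr p"
        by (rule tendsto_powr'[OF _ tendsto_const]) (use p in auto)
    qed
    have "ennreal (cmod (\<Sum>n<m. a n * g n x) powr p)
        \<le> ennreal (S powr p) * (\<Sum>n. ennreal (w n * y n x powr p))" for m
    proof -
      have "cmod (\<Sum>n<m. a n * g n x) \<le> (\<Sum>n<m. cmod (a n * g n x))" by (rule norm_sum)
      also have "\<dots> = S * (\<Sum>n<m. w n * y n x)"
        unfolding sum_distrib_left using b S
        by (intro sum.cong) (auto simp: w_def y_def norm_mult less_le)
      finally have "cmod (\<Sum>n<m. a n * g n x) powr p \<le> (S * (\<Sum>n<m. w n * y n x)) powr p"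
        using p by (intro powr_mono2) auto
      also have "\<dots> = S powr p * (\<Sum>n<m. w n * y n x) powr p"
        using S w0 b by (intro powr_mult)
      also have "(\<Sum>n<m. w n * y n x) powr p \<le> (\<Sum>n<m. w n * y n x powr p)"
      proof (rule powr_weighted_sum_le[OF p])
        show "sum w {..<m} \<le> 1"
          using sum_le_suminf[OF ws, of "{..<m}"] w0 wsum by auto
        show "0 \<le> y n x" for n using b[of n] by (simp add: y_def)
      qed (rule w0)
      finally have "ennreal (cmod (\<Sum>n<m. a n * g n x) powr p)
          \<le> ennreal (S powr p * (\<Sum>n<m. w n * y n x powr p))"
        by (simp add: ennreal_leI mult_left_mono)
      also have "\<dots> = ennreal (S powr p) * (\<Sum>n<m. ennreal (w n * y n x powr p))"
        using w0 by (subst ennreal_mult) (auto intro!: sum_nonneg)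
      also have "\<dots> \<le> ennreal (S powr p) * (\<Sum>n. ennreal (w n * y n x powr p))"
        by (intro mult_left_mono sum_le_suminf) auto
      finally show ?thesis .
    qed
    then show "\<exists>N. \<forall>m\<ge>N. ennreal (cmod (\<Sum>n<m. a n * g n x) powr p)
        \<le> ennreal (S powr p) * (\<Sum>n. ennreal (w n * y n x powr p))" by blast
  qed
  have yN: "(\<integral>\<^sup>+x. ennreal (w n * y n x powr p) \<partial>lebesgue) \<le> ennreal (w n) * ennreal (N powr p)" for n
  proof -
    have int: "integrable lebesgue (\<lambda>x. cmod (g n x) powr p)" using g by (simp add: Lp_fun_def)
    have "(LINT x|lebesgue. cmod (g n x) powr p) \<le> (b n * N) powr p"
      using g(2)[of n] b[of n] N p by (subst Lp_norm_le_iff[symmetric]) auto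
    then have "(LINT x|lebesgue. cmod (g n x) powr p) / b n powr p \<le> N powr p"
      using b[of n] N by (simp add: powr_mult field_simps)
    moreover have yeq: "y n x powr p = cmod (g n x) powr p / b n powr p" for x
      using b[of n] by (simp add: y_def powr_divide)
    ultimately have "(\<integral>\<^sup>+x. ennreal (y n x powr p) \<partial>lebesgue) \<le> ennreal (N powr p)"
      using int by (simp add: nn_integral_eq_integral)
    then show ?thesis
      using w0 by (simp add: ennreal_mult nn_integral_cmult mult_left_mono)
  qed
  \<comment> \<open>Nonnegative integrals permit the exchange with the sum unconditionally, and
    their finiteness yields the integrability of \<open>h\<close> to the power \<open>p\<close>
    together with the estimate.\<close>
  have "(\<integral>\<^sup>+x. ennreal (cmod (h x) powr p) \<partial>lebesgue)
      \<le> (\<integral>\<^sup>+x. ennreal (S powr p) * (\<Sum>n. ennreal (w n * y n x powr p)) \<partial>lebesgue)"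
    using h by (intro nn_integral_mono_AE) (auto elim!: eventually_mono intro: pw)
  also have "\<dots> = ennreal (S powr p) * (\<Sum>n. \<integral>\<^sup>+x. ennreal (w n * y n x powr p) \<partial>lebesgue)"
    by (simp add: nn_integral_cmult nn_integral_suminf)
  also have "\<dots> \<le> ennreal (S powr p) * (\<Sum>n. ennreal (w n) * ennreal (N powr p))"
    by (intro mult_left_mono suminf_le yN) auto
  also have "\<dots> = ennreal (S powr p) * (ennreal (suminf w) * ennreal (N powr p))"
    using w0 ws by (simp add: suminf_ennreal2)
  also have "\<dots> \<le> ennreal (S powr p) * (ennreal 1 * ennreal (N powr p))"
    using wsum by (intro mult_left_mono mult_right_mono ennreal_leI) auto
  also have "\<dots> = ennreal ((S * N) powr p)"
    using S N by (simp add: powr_mult ennreal_mult)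
  finally have le: "(\<integral>\<^sup>+x. ennreal (cmod (h x) powr p) \<partial>lebesgue) \<le> ennreal ((S * N) powr p)" .
  have int: "integrable lebesgue (\<lambda>x. cmod (h x) powr p)"
    by (rule integrableI_bounded) (use le in \<open>auto simp: less_top[symmetric] top_unique\<close>)
  then show "Lp_fun p h" using hm by (simp add: Lp_fun_def)
  have "ennreal (LINT x|lebesgue. cmod (h x) powr p) \<le> ennreal ((S * N) powr p)"
    using le int by (simp add: nn_integral_eq_integral)
  then have "(LINT x|lebesgue. cmod (h x) powr p) \<le> (S * N) powr p"
    by simp
  then show "Lp_norm p h \<le> S * N"
    using S N p by (subst Lp_norm_le_iff) auto
qed

section \<open>Measurability of slices and integrability of test functions\<close>

text \<open>A Lebesgue measurable function agrees with a Borel function off a null set of the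
  product. Almost every slice of that null set is null, and completeness of Lebesgue measure carries
  measurability over from the Borel slice.\<close>

lemma AE_lebesgue_measurable_slice:
  fixes f :: "'a::euclidean_space \<times> 'b::euclidean_space \<Rightarrow> real"
  assumes "f \<in> borel_measurable lebesgue"
  shows "AE x in lebesgue. (\<lambda>y. f (x, y)) \<in> borel_measurable lebesgue"
proof -
  obtain g where g[measurable]: "g \<in> borel_measurable lborel" and "AE w in lborel. f w = g w"
    using completion_ex_borel_measurable_real[OF assms] by auto
  then have "AE w in lborel \<Otimes>\<^sub>M lborel. f w = g w" unfolding lborel_prod by blast
  then have "AE x in lborel. AE y in lborel. f (x, y) = g (x, y)" by (rule lborel_pair.AE_pair)
  then show ?thesis
  proof (rule AE_completion[OF eventually_mono])
    fix x assume "AE y in lborel. f (x, y) = g (x, y)"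
    then have ae: "AE y in lebesgue. g (x, y) = f (x, y)"
      by (intro AE_completion) (auto elim: eventually_mono)
    have "(\<lambda>y. g (x, y)) \<in> borel_measurable lebesgue"
      using g by (intro measurable_completion) measurable
    from borel_measurable_AE[OF this ae] show "(\<lambda>y. f (x, y)) \<in> borel_measurable lebesgue" .
  qed
qed

lemma test_function_integrable:
  assumes "test_function f"
  shows "integrable lebesgue f"
proof -
  let ?S = "closure {x. f x \<noteq> 0}"
  have "C_k_fun 0 f" "compact ?S" using assms by (auto simp: test_function_def)
  then have "integrable lborel (\<lambda>x. indicator ?S x *\<^sub>R f x)"
    by (intro borel_integrable_compact) (auto intro: continuous_on_subset)
  moreover have "(\<lambda>x. indicator ?S x *\<^sub>R f x) = f"
    using closure_subset[of "{x. f x \<noteq> 0}"] by (auto simp: fun_eq_iff indicator_def)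
  ultimately have "integrable lborel f" by simp
  then show ?thesis
    by (subst integrable_completion) (auto intro: borel_measurable_integrable)
qed

subsection \<open>Modulated powers of the phase\<close>

text \<open>The exponentials have modulus 1, so the n-th integrand has norm
  \<open>cmod (a n) * cmod (\<phi> y)\<close>; this is summable after integration, and sum and
  integral may be exchanged.\<close>

lemma integral_linear_exp_series:
  fixes \<phi> :: "'a \<Rightarrow> complex" and q :: "'a \<Rightarrow> real"
  assumes \<phi>: "integrable M \<phi>" and q[measurable]: "q \<in> borel_measurable M"
    and B: "\<And>y. \<bar>q y\<bar> \<le> B" and sm: "summable (\<lambda>n. cmod (a n))"
    and ser: "\<And>u. \<bar>u\<bar> \<le> B \<Longrightarrow> (\<lambda>n. a n * exp (\<i> * of_real (\<tau> n * u))) sums of_real u"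
  shows "(\<lambda>n. a n * (LINT y|M. \<phi> y * exp (\<i> * of_real ((t + \<tau> n) * q y))))
    sums (LINT y|M. \<phi> y * of_real (q y) * exp (\<i> * of_real (t * q y)))"
proof -
  have [measurable]: "\<phi> \<in> borel_measurable M" using \<phi> by simp
  let ?F = "\<lambda>n y. a n * (\<phi> y * exp (\<i> * of_real ((t + \<tau> n) * q y)))"
  have nF: "norm (?F n y) = cmod (a n) * cmod (\<phi> y)" for n y
    by (simp add: norm_mult)
  have int: "integrable M (?F n)" for n
    by (rule Bochner_Integration.integrable_bound[of _ "\<lambda>y. a n * \<phi> y"])
      (use \<phi> in \<open>auto simp: norm_mult\<close>)
  have "(\<lambda>n. integral\<^sup>L M (?F n)) sums (LINT y|M. (\<Sum>n. ?F n y))"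
  proof (rule sums_integral[OF int])
    show "AE y in M. summable (\<lambda>n. norm (?F n y))"
      unfolding nF by (intro always_eventually allI summable_mult2 sm)
    show "summable (\<lambda>n. LINT y|M. norm (?F n y))"
      unfolding nF using \<phi> by (simp add: summable_mult2 sm)
  qed
  moreover have "(\<Sum>n. ?F n y) = \<phi> y * of_real (q y) * exp (\<i> * of_real (t * q y))" for y
  proof -
    have "?F n y = (\<phi> y * exp (\<i> * of_real (t * q y))) * (a n * exp (\<i> * of_real (\<tau> n * q y)))" for n
    proof -
      have "exp (\<i> * of_real ((t + \<tau> n) * q y)) = exp (\<i> * of_real (t * q y)) * exp (\<i> * of_real (\<tau> n * q y))"
        unfolding exp_add[symmetric] by (simp add: algebra_simps)
      then show ?thesis by (simp only: mult_ac)
    qed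
    moreover have "(\<lambda>n. (\<phi> y * exp (\<i> * of_real (t * q y))) * (a n * exp (\<i> * of_real (\<tau> n * q y))))
        sums ((\<phi> y * exp (\<i> * of_real (t * q y))) * of_real (q y))"
      by (intro sums_mult ser B)
    ultimately have "(\<lambda>n. ?F n y) sums ((\<phi> y * exp (\<i> * of_real (t * q y))) * of_real (q y))"
      by (simp only:)
    then show ?thesis by (simp only: sums_iff mult_ac)
  qed
  ultimately show ?thesis by simp
qed

text \<open>This family contains the kernels of both operators, at \<open>k = 0\<close> and at
  \<open>t = 0\<close>. Keeping the modulation \<open>t\<close> free is what lets an induction on
  \<open>k\<close> close, since expanding one factor \<open>Q\<close> shifts
  \<open>t\<close>.\<close>

definition modulated_kernel :: "('a \<times> 'a \<Rightarrow> real) \<Rightarrow> ('a \<times> 'a \<Rightarrow> real) \<Rightarrow> nat \<Rightarrow> real \<Rightarrow> 'a \<times> 'a \<Rightarrow> complex" where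
  "modulated_kernel K Q k t w = of_real (K w * Q w ^ k) * exp (\<i> * of_real (t * Q w))"

text \<open>The majorant needed for limits under the sum over frequencies: \<open>G\<close> and
  \<open>\<epsilon>0\<close> may depend on the point \<open>x\<close> but not on the frequency
  \<open>t\<close>, whose growth is measured by \<open>W\<close>.\<close>

definition dominated_truncations ::
  "(real \<Rightarrow> real) \<Rightarrow> (real \<Rightarrow> 'a::euclidean_space \<times> 'a \<Rightarrow> complex) \<Rightarrow> ('a \<Rightarrow> complex) \<Rightarrow> 'a \<Rightarrow> bool" where
  "dominated_truncations W \<kappa> f x \<longleftrightarrow>
     (\<exists>G. \<exists>\<epsilon>0>0. \<forall>t \<epsilon>. 0 < \<epsilon> \<longrightarrow> \<epsilon> < \<epsilon>0 \<longrightarrow> cmod (truncated_op (\<kappa> t) \<epsilon> f x) \<le> G * W t)"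

lemma truncated_integrand_integrable:
  fixes K Q :: "'a::euclidean_space \<times> 'a \<Rightarrow> real" and f :: "'a \<Rightarrow> complex"
  assumes K: "(\<lambda>y. K (x, y)) \<in> borel_measurable lebesgue"
    and Q: "(\<lambda>y. Q (x, y)) \<in> borel_measurable lebesgue"
    and size: "\<And>y. x \<noteq> y \<Longrightarrow> \<bar>K (x, y)\<bar> \<le> C0 * dist x y powr (- d)" and d: "0 \<le> d"
    and B: "\<And>w. \<bar>Q w\<bar> \<le> B" and f: "integrable lebesgue f" and \<epsilon>: "\<epsilon> > 0"
  shows "integrable lebesgue (\<lambda>y. indicator {y. dist x y > \<epsilon>} y *\<^sub>R (of_real (K (x, y) * Q (x, y) ^ k) * f y))"
proof (rule Bochner_Integration.integrable_bound)
  show "integrable lebesgue (\<lambda>y. of_real (\<bar>C0\<bar> * \<epsilon> powr (-d) * B ^ k) * f y)"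
    using f by simp
  have [measurable]: "f \<in> borel_measurable lebesgue" using f by simp
  note K[measurable] Q[measurable]
  have "{y. dist x y > \<epsilon>} \<in> sets borel"
    by (intro borel_open open_Collect_less continuous_intros)
  then have [measurable]: "{y. dist x y > \<epsilon>} \<in> sets lebesgue" by simp
  show "(\<lambda>y. indicator {y. dist x y > \<epsilon>} y *\<^sub>R (of_real (K (x, y) * Q (x, y) ^ k) * f y))
      \<in> borel_measurable lebesgue" by measurable
  show "AE y in lebesgue. norm (indicator {y. dist x y > \<epsilon>} y *\<^sub>R (of_real (K (x, y) * Q (x, y) ^ k) * f y))
      \<le> norm (of_real (\<bar>C0\<bar> * \<epsilon> powr (-d) * B ^ k) * f y)"
  proof (rule always_eventually, rule allI)
    fix y
    show "norm (indicator {y. dist x y > \<epsilon>} y *\<^sub>R (of_real (K (x, y) * Q (x, y) ^ k) * f y))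
      \<le> norm (of_real (\<bar>C0\<bar> * \<epsilon> powr (-d) * B ^ k) * f y)"
    proof (cases "dist x y > \<epsilon>")
      case True
      have B0: "0 \<le> B" using B[of "(x, y)"] by linarith
      have "\<bar>K (x, y)\<bar> \<le> C0 * dist x y powr (- d)" using True \<epsilon> by (intro size) auto
      also have "\<dots> \<le> \<bar>C0\<bar> * dist x y powr (- d)" by (intro mult_right_mono) auto
      also have "\<dots> \<le> \<bar>C0\<bar> * \<epsilon> powr (- d)"
        using True \<epsilon> d by (intro mult_left_mono powr_mono2') auto
      finally have "\<bar>K (x, y)\<bar> * \<bar>Q (x, y)\<bar> ^ k \<le> \<bar>C0\<bar> * \<epsilon> powr (- d) * B ^ k"
        using B by (intro mult_mono power_mono) auto
      then have "\<bar>K (x, y)\<bar> * \<bar>Q (x, y)\<bar> ^ k * cmod (f y) \<le> \<bar>C0\<bar> * \<epsilon> powr (- d) * B ^ k * cmod (f y)"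
        by (intro mult_right_mono) auto
      then show ?thesis using True B0
        by (simp add: norm_mult norm_power abs_mult power_abs)
    qed simp
  qed
qed

lemma modulated_kernel_Suc_truncated_sums:
  fixes K Q :: "'a::euclidean_space \<times> 'a \<Rightarrow> real" and f :: "'a \<Rightarrow> complex"
  assumes K: "(\<lambda>y. K (x, y)) \<in> borel_measurable lebesgue"
    and Q: "(\<lambda>y. Q (x, y)) \<in> borel_measurable lebesgue"
    and size: "\<And>y. x \<noteq> y \<Longrightarrow> \<bar>K (x, y)\<bar> \<le> C0 * dist x y powr (- d)" and d: "0 \<le> d"
    and B: "\<And>w. \<bar>Q w\<bar> \<le> B" and f: "integrable lebesgue f" and \<epsilon>: "\<epsilon> > 0"
    and sm: "summable (\<lambda>n. cmod (a n))"
    and ser: "\<And>u. \<bar>u\<bar> \<le> B \<Longrightarrow> (\<lambda>n. a n * exp (\<i> * of_real (\<tau> n * u))) sums of_real u"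
  shows "(\<lambda>n. a n * truncated_op (modulated_kernel K Q k (t + \<tau> n)) \<epsilon> f x)
    sums truncated_op (modulated_kernel K Q (Suc k) t) \<epsilon> f x"
  using integral_linear_exp_series[OF truncated_integrand_integrable[OF K Q size d B f \<epsilon>] Q B sm ser, of k t]
  by (simp add: truncated_op_def modulated_kernel_def set_lebesgue_integral_def mult_ac scaleR_conv_of_real)

lemma pv_exists_pv_op: "pv_exists \<kappa> f x \<Longrightarrow> ((\<lambda>\<epsilon>. truncated_op \<kappa> \<epsilon> f x) \<longlongrightarrow> pv_op \<kappa> f x) (at_right 0)"
  unfolding pv_exists_def pv_op_def using tendsto_Lim[OF trivial_limit_at_right_real] by metis

section \<open>Principal values of the series and the step from one power of the phase to the
  next\<close>

text \<open>Submultiplicativity of \<open>W\<close> gives the n-th term the majorant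
  \<open>G * W t * (cmod (a n) * W (\<tau> n))\<close>, uniformly in small
  \<open>\<epsilon>\<close>. Tannery's theorem then takes the limit inside the sum. The domination
  is passed on to the new kernel so that the step can be repeated.\<close>

lemma truncations_sums_imp_pv_sums:
  fixes \<kappa> :: "real \<Rightarrow> 'a::euclidean_space \<times> 'a \<Rightarrow> complex"
  assumes W: "\<And>t. 0 < W t" "\<And>t t'. W (t + t') \<le> W t * W t'"
    and sm: "summable (\<lambda>n. cmod (a n) * W (\<tau> n))"
    and sums: "\<And>t \<epsilon>. 0 < \<epsilon> \<Longrightarrow> (\<lambda>n. a n * truncated_op (\<kappa> (t + \<tau> n)) \<epsilon> f x) sums truncated_op (\<kappa>' t) \<epsilon> f x"
    and dom: "dominated_truncations W \<kappa> f x"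
  shows "dominated_truncations W \<kappa>' f x"
    and "(\<And>n. pv_exists (\<kappa> (t + \<tau> n)) f x) \<Longrightarrow>
      pv_exists (\<kappa>' t) f x \<and> (\<lambda>n. a n * pv_op (\<kappa> (t + \<tau> n)) f x) sums pv_op (\<kappa>' t) f x"
proof -
  obtain G \<epsilon>0 where \<epsilon>0: "\<epsilon>0 > 0"
    and G: "\<And>t \<epsilon>. 0 < \<epsilon> \<Longrightarrow> \<epsilon> < \<epsilon>0 \<Longrightarrow> cmod (truncated_op (\<kappa> t) \<epsilon> f x) \<le> G * W t"
    using dom unfolding dominated_truncations_def by metis
  have "0 \<le> G * W 0" using G[of "\<epsilon>0/2" 0] \<epsilon>0 by (smt (verit) norm_ge_zero field_sum_of_halves)
  then have G0: "0 \<le> G" using W(1)[of 0] by (simp add: zero_le_mult_iff)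
  have bnd: "norm (a n * truncated_op (\<kappa> (t + \<tau> n)) \<epsilon> f x) \<le> G * W t * (cmod (a n) * W (\<tau> n))"
    if "0 < \<epsilon>" "\<epsilon> < \<epsilon>0" for n t \<epsilon>
  proof -
    have "cmod (truncated_op (\<kappa> (t + \<tau> n)) \<epsilon> f x) \<le> G * W (t + \<tau> n)" using G that .
    also have "\<dots> \<le> G * (W t * W (\<tau> n))" using G0 W by (intro mult_left_mono)
    finally have "cmod (a n) * cmod (truncated_op (\<kappa> (t + \<tau> n)) \<epsilon> f x) \<le> cmod (a n) * (G * (W t * W (\<tau> n)))"
      by (intro mult_left_mono) auto
    then show ?thesis by (simp add: norm_mult mult_ac)
  qed
  have sm': "summable (\<lambda>n. G * W t * (cmod (a n) * W (\<tau> n)))" for t by (intro summable_mult sm)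
  show "dominated_truncations W \<kappa>' f x"
    unfolding dominated_truncations_def
  proof (rule exI[of _ "G * (\<Sum>n. cmod (a n) * W (\<tau> n))"], rule exI[of _ \<epsilon>0], intro conjI allI impI)
    fix t \<epsilon> :: real assume \<epsilon>: "0 < \<epsilon>" "\<epsilon> < \<epsilon>0"
    have "cmod (truncated_op (\<kappa>' t) \<epsilon> f x) = cmod (\<Sum>n. a n * truncated_op (\<kappa> (t + \<tau> n)) \<epsilon> f x)"
      using sums[OF \<epsilon>(1), of t] by (simp add: sums_iff)
    also have "\<dots> \<le> (\<Sum>n. G * W t * (cmod (a n) * W (\<tau> n)))"
      by (rule norm_suminf_le[OF bnd[OF \<epsilon>] sm'])
    also have "\<dots> = G * (\<Sum>n. cmod (a n) * W (\<tau> n)) * W t"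
      using suminf_mult[OF sm, of "G * W t"] by (simp add: mult_ac)
    finally show "cmod (truncated_op (\<kappa>' t) \<epsilon> f x) \<le> G * (\<Sum>n. cmod (a n) * W (\<tau> n)) * W t" .
  qed (rule \<epsilon>0)
  assume pv: "\<And>n. pv_exists (\<kappa> (t + \<tau> n)) f x"
  have T: "eventually (\<lambda>\<epsilon>. summable (\<lambda>n. norm (a n * truncated_op (\<kappa> (t + \<tau> n)) \<epsilon> f x))) (at_right 0) \<and>
      summable (\<lambda>n. norm (a n * pv_op (\<kappa> (t + \<tau> n)) f x)) \<and>
      ((\<lambda>\<epsilon>. \<Sum>n. a n * truncated_op (\<kappa> (t + \<tau> n)) \<epsilon> f x) \<longlongrightarrow>
        (\<Sum>n. a n * pv_op (\<kappa> (t + \<tau> n)) f x)) (at_right 0)"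
  proof (rule tannerys_theorem[OF _ _ sm'])
    show "((\<lambda>\<epsilon>. a n * truncated_op (\<kappa> (t + \<tau> n)) \<epsilon> f x) \<longlongrightarrow> a n * pv_op (\<kappa> (t + \<tau> n)) f x) (at_right 0)" for n
      by (intro tendsto_mult tendsto_const pv_exists_pv_op pv)
    have "eventually (\<lambda>\<epsilon>. \<epsilon> \<in> {0<..<\<epsilon>0}) (at_right 0)" by (rule eventually_at_right_real[OF \<epsilon>0])
    then have "eventually (\<lambda>\<epsilon>. \<forall>n. norm (a n * truncated_op (\<kappa> (t + \<tau> n)) \<epsilon> f x) \<le> G * W t * (cmod (a n) * W (\<tau> n)))
        (at_right 0)"
      by (rule eventually_mono) (auto intro: bnd)
    then have "eventually (\<lambda>p. True \<and> (\<forall>n. norm (a n * truncated_op (\<kappa> (t + \<tau> n)) (snd p) f x)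
        \<le> G * W t * (cmod (a n) * W (\<tau> n)))) (sequentially \<times>\<^sub>F at_right 0)"
      using eventually_prodI[OF always_eventually[of "\<lambda>n. True" sequentially]] by simp
    then show "eventually (\<lambda>(n, \<epsilon>). norm (a n * truncated_op (\<kappa> (t + \<tau> n)) \<epsilon> f x) \<le> G * W t * (cmod (a n) * W (\<tau> n)))
        (at_top \<times>\<^sub>F at_right 0)"
      by (rule eventually_mono) auto
  qed simp
  have "eventually (\<lambda>\<epsilon>. truncated_op (\<kappa>' t) \<epsilon> f x = (\<Sum>n. a n * truncated_op (\<kappa> (t + \<tau> n)) \<epsilon> f x)) (at_right 0)"
    using eventually_at_right_less[of 0]
    by eventually_elim (use sums in \<open>simp add: sums_iff\<close>)
  with T have lim: "((\<lambda>\<epsilon>. truncated_op (\<kappa>' t) \<epsilon> f x) \<longlongrightarrow> (\<Sum>n. a n * pv_op (\<kappa> (t + \<tau> n)) f x)) (at_right 0)"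
    by (simp add: tendsto_cong)
  then have ex: "pv_exists (\<kappa>' t) f x" unfolding pv_exists_def by blast
  have "pv_op (\<kappa>' t) f x = (\<Sum>n. a n * pv_op (\<kappa> (t + \<tau> n)) f x)"
    unfolding pv_op_def by (rule tendsto_Lim[OF _ lim[unfolded pv_op_def]]) simp
  moreover have "summable (\<lambda>n. a n * pv_op (\<kappa> (t + \<tau> n)) f x)"
    by (rule summable_norm_cancel) (use T in blast)
  ultimately show "pv_exists (\<kappa>' t) f x \<and> (\<lambda>n. a n * pv_op (\<kappa> (t + \<tau> n)) f x) sums pv_op (\<kappa>' t) f x"
    using ex by (simp add: sums_iff)
qed

lemma modulated_kernel_bounded_Suc:
  fixes K Q :: "'a::euclidean_space \<times> 'a \<Rightarrow> real"
  assumes p: "1 \<le> p"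
    and meas: "K \<in> borel_measurable lebesgue" "Q \<in> borel_measurable lebesgue"
    and size: "\<And>x y. x \<noteq> y \<Longrightarrow> \<bar>K (x, y)\<bar> \<le> C0 * dist x y powr (- d)" and d: "0 \<le> d"
    and B: "\<And>w. \<bar>Q w\<bar> \<le> B"
    and W: "\<And>t. 1 \<le> W t" "\<And>t t'. W (t + t') \<le> W t * W t'"
    and sm: "summable (\<lambda>n. cmod (a n) * W (\<tau> n))" "(\<Sum>n. cmod (a n) * W (\<tau> n)) \<le> D" and D: "0 < D"
    and ser: "\<And>u. \<bar>u\<bar> \<le> B \<Longrightarrow> (\<lambda>n. a n * exp (\<i> * of_real (\<tau> n * u))) sums of_real u"
    and C: "0 < C"
    and bounded: "\<And>t. pv_op_bounded p (modulated_kernel K Q k t) (C * W t)"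
    and dom: "\<And>f. test_function f \<Longrightarrow> AE x in lebesgue. dominated_truncations W (modulated_kernel K Q k) f x"
  shows "pv_op_bounded p (modulated_kernel K Q (Suc k) t) (C * D * W t)"
    and "test_function f \<Longrightarrow> AE x in lebesgue. dominated_truncations W (modulated_kernel K Q (Suc k)) f x"
proof -
  have W0: "0 < W t" for t using W(1)[of t] by linarith
  have sma: "summable (\<lambda>n. cmod (a n))"
  proof (rule summable_comparison_test'[OF sm(1)])
    show "norm (cmod (a n)) \<le> cmod (a n) * W (\<tau> n)" for n
      using mult_left_mono[OF W(1), of "cmod (a n)"] by simp
  qed
  \<comment> \<open>The exceptional null set comes from the slices of \<open>K\<close> and
    \<open>Q\<close> alone, so it serves all \<open>t\<close> and \<open>\<epsilon>\<close> at
    once.\<close>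
  have ts: "AE x in lebesgue. \<forall>t \<epsilon>. 0 < \<epsilon> \<longrightarrow>
      (\<lambda>n. a n * truncated_op (modulated_kernel K Q k (t + \<tau> n)) \<epsilon> f x)
        sums truncated_op (modulated_kernel K Q (Suc k) t) \<epsilon> f x" if f: "test_function f" for f
    using AE_lebesgue_measurable_slice[OF meas(1)] AE_lebesgue_measurable_slice[OF meas(2)]
  proof eventually_elim
    case (elim x)
    then show ?case
      using modulated_kernel_Suc_truncated_sums[OF elim size d B test_function_integrable[OF f] _ sma ser]
      by blast
  qed
  show "AE x in lebesgue. dominated_truncations W (modulated_kernel K Q (Suc k)) f x"
    if f: "test_function f" for f
    using ts[OF f] dom[OF f]
  proof eventually_elim
    case (elim x)
    then show ?case
      using truncations_sums_imp_pv_sums(1)[OF W0 W(2) sm(1), of "modulated_kernel K Q k" f x "modulated_kernel K Q (Suc k)"]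
      by blast
  qed
  show "pv_op_bounded p (modulated_kernel K Q (Suc k) t) (C * D * W t)"
    unfolding pv_op_bounded_def
  proof (intro allI impI)
    fix f :: "'a \<Rightarrow> complex" assume f: "test_function f"
    \<comment> \<open>Here the null sets do depend on the frequency, but for fixed \<open>t\<close>
      only the countably many \<open>t + \<tau> n\<close> occur.\<close>
    have "AE x in lebesgue. \<forall>n. pv_exists (modulated_kernel K Q k (t + \<tau> n)) f x"
      using bounded f by (simp add: AE_all_countable pv_op_bounded_def)
    with ts[OF f] dom[OF f]
    have lim: "AE x in lebesgue. pv_exists (modulated_kernel K Q (Suc k) t) f x \<and>
        (\<lambda>n. a n * pv_op (modulated_kernel K Q k (t + \<tau> n)) f x) sums pv_op (modulated_kernel K Q (Suc k) t) f x"
    proof eventually_elim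
      case (elim x)
      then show ?case
        using truncations_sums_imp_pv_sums(2)[OF W0 W(2) sm(1), of "modulated_kernel K Q k" f x "modulated_kernel K Q (Suc k)" t]
        by blast
    qed
    let ?b = "\<lambda>n. C * W t * W (\<tau> n)"
    have gb: "Lp_norm p (pv_op (modulated_kernel K Q k (t + \<tau> n)) f) \<le> ?b n * Lp_norm p f" for n
    proof -
      have "Lp_norm p (pv_op (modulated_kernel K Q k (t + \<tau> n)) f) \<le> C * W (t + \<tau> n) * Lp_norm p f"
        using bounded f by (simp add: pv_op_bounded_def)
      also have "\<dots> \<le> ?b n * Lp_norm p f"
        using W(2)[of t "\<tau> n"] C by (intro mult_right_mono Lp_norm_nonneg) (simp add: mult.assoc)
      finally show ?thesis .
    qed
    have sb: "summable (\<lambda>n. cmod (a n) * ?b n)"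
      using summable_mult[OF sm(1), of "C * W t"] by (simp add: mult_ac)
    have "(\<Sum>n. cmod (a n) * ?b n) = C * W t * (\<Sum>n. cmod (a n) * W (\<tau> n))"
      using suminf_mult[OF sm(1), of "C * W t"] by (simp add: mult_ac)
    also have "\<dots> \<le> C * W t * D"
      using C W0[of t] sm(2) by (intro mult_left_mono) auto
    finally have "(\<Sum>n. cmod (a n) * ?b n) \<le> C * D * W t" by (simp add: mult_ac)
    note L = Lp_sums[OF p _ Lp_norm_nonneg _ sb this _ gb, of "pv_op (modulated_kernel K Q (Suc k) t) f"]
    have "Lp_fun p (pv_op (modulated_kernel K Q (Suc k) t) f)"
        "Lp_norm p (pv_op (modulated_kernel K Q (Suc k) t) f) \<le> C * D * W t * Lp_norm p f"
      by (rule L; use C D W0 bounded f lim in \<open>auto simp: pv_op_bounded_def\<close>)+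
    then show "(AE x in lebesgue. pv_exists (modulated_kernel K Q (Suc k) t) f x) \<and>
        Lp_fun p (pv_op (modulated_kernel K Q (Suc k) t) f) \<and>
        Lp_norm p (pv_op (modulated_kernel K Q (Suc k) t) f) \<le> C * D * W t * Lp_norm p f"
      using lim by (auto elim: eventually_mono)
  qed
qed

section \<open>Uniform domination of the truncations from the near-diagonal estimate\<close>

text \<open>The truncation at \<open>t\<close> is compared with \<open>A t x\<close> times the
  truncation at frequency 0. The latter stays bounded for small \<open>\<epsilon>\<close> because it
  converges. The difference has kernel \<open>K * (exp (\<i> * t * Q) - A)\<close>, at most
  \<open>W t\<close> near the diagonal by hypothesis and at most \<open>2 * \<bar>C0\<bar>\<close>
  at distance 1 or more by the size condition.\<close>

lemma modulated_kernel_0_dominated: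
  fixes K Q :: "'a::euclidean_space \<times> 'a \<Rightarrow> real" and A :: "real \<Rightarrow> 'a \<Rightarrow> complex" and f :: "'a \<Rightarrow> complex"
  assumes K: "(\<lambda>y. K (x, y)) \<in> borel_measurable lebesgue"
    and Q: "(\<lambda>y. Q (x, y)) \<in> borel_measurable lebesgue"
    and size: "\<And>y. x \<noteq> y \<Longrightarrow> \<bar>K (x, y)\<bar> \<le> C0 * dist x y powr (- d)" and d: "0 \<le> d"
    and B: "\<And>w. \<bar>Q w\<bar> \<le> B" and f: "integrable lebesgue f" and W: "\<And>t. 1 \<le> W t"
    and near: "\<And>t y. dist x y < 1 \<Longrightarrow>
      cmod (of_real (K (x, y)) * (exp (\<i> * of_real (t * Q (x, y))) - A t x)) \<le> W t"
    and A: "\<And>t. cmod (A t x) \<le> 1"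
    and pv: "pv_exists (modulated_kernel K Q 0 0) f x"
  shows "dominated_truncations W (modulated_kernel K Q 0) f x"
proof -
  let ?\<kappa> = "modulated_kernel K Q 0"
  define N where "N = (LINT y|lebesgue. cmod (f y))"
  \<comment> \<open>The first two summands bound the truncation at frequency 0, the last one the
    difference; \<open>1 \<le> W t\<close> lets all of them be multiplied by
    \<open>W t\<close>.\<close>
  define G where "G = cmod (pv_op (?\<kappa> 0) f x) + 1 + (1 + 2 * \<bar>C0\<bar>) * N"
  have N: "0 \<le> N" unfolding N_def by (intro integral_nonneg_AE) auto
  have "eventually (\<lambda>\<epsilon>. dist (truncated_op (?\<kappa> 0) \<epsilon> f x) (pv_op (?\<kappa> 0) f x) < 1) (at_right 0)"
    using tendstoD[OF pv_exists_pv_op[OF pv]] by simp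
  then obtain \<epsilon>0 where \<epsilon>0: "0 < \<epsilon>0"
    and near_pv: "\<And>\<epsilon>. 0 < \<epsilon> \<Longrightarrow> \<epsilon> < \<epsilon>0 \<Longrightarrow> dist (truncated_op (?\<kappa> 0) \<epsilon> f x) (pv_op (?\<kappa> 0) f x) < 1"
    unfolding eventually_at_right_field by auto
  have "cmod (truncated_op (?\<kappa> t) \<epsilon> f x) \<le> G * W t" if \<epsilon>: "0 < \<epsilon>" "\<epsilon> < \<epsilon>0" for t \<epsilon>
  proof -
    let ?S = "{y. dist x y > \<epsilon>}"
    define \<phi> where "\<phi> y = indicator ?S y *\<^sub>R (of_real (K (x, y)) * f y)" for y
    have \<phi>: "integrable lebesgue \<phi>"
      using truncated_integrand_integrable[OF K Q size d B f \<epsilon>(1), of 0] by (simp add: \<phi>_def[abs_def])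
    have [measurable]: "\<phi> \<in> borel_measurable lebesgue" using \<phi> by simp
    note Q[measurable]
    have e: "integrable lebesgue (\<lambda>y. exp (\<i> * of_real (t * Q (x, y))) * \<phi> y)"
      by (rule Bochner_Integration.integrable_bound[OF \<phi>]) (auto simp: norm_mult)
    have T: "truncated_op (?\<kappa> t) \<epsilon> f x = (LINT y|lebesgue. exp (\<i> * of_real (t * Q (x, y))) * \<phi> y)" for t
      unfolding truncated_op_def set_lebesgue_integral_def modulated_kernel_def \<phi>_def
      by (simp add: scaleR_conv_of_real mult_ac)
    have "truncated_op (?\<kappa> t) \<epsilon> f x - A t x * truncated_op (?\<kappa> 0) \<epsilon> f x
        = (LINT y|lebesgue. exp (\<i> * of_real (t * Q (x, y))) * \<phi> y - A t x * \<phi> y)"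
      using e \<phi> by (simp add: T)
    also have "cmod \<dots> \<le> (LINT y|lebesgue. (W t + 2 * \<bar>C0\<bar>) * cmod (f y))"
    proof (rule Bochner_Integration.integral_norm_bound_integral)
      show "integrable lebesgue (\<lambda>y. exp (\<i> * of_real (t * Q (x, y))) * \<phi> y - A t x * \<phi> y)"
        using e \<phi> by simp
      show "integrable lebesgue (\<lambda>y. (W t + 2 * \<bar>C0\<bar>) * cmod (f y))" using f by simp
      fix y
      let ?m = "of_real (K (x, y)) * (exp (\<i> * of_real (t * Q (x, y))) - A t x)"
      have "cmod ?m \<le> W t + 2 * \<bar>C0\<bar>" if y: "y \<in> ?S"
      proof (cases "dist x y < 1")
        case True
        then show ?thesis using near[of y t] by simp
      next
        case False
        then have "\<bar>K (x, y)\<bar> \<le> C0 * dist x y powr (- d)" by (intro size) auto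
        also have "\<dots> \<le> \<bar>C0\<bar> * dist x y powr (- d)" by (intro mult_right_mono) auto
        also have "\<dots> \<le> \<bar>C0\<bar> * 1 powr (- d)"
          using False d by (intro mult_left_mono powr_mono2') auto
        finally have k: "\<bar>K (x, y)\<bar> \<le> \<bar>C0\<bar>" by simp
        have "cmod (exp (\<i> * of_real (t * Q (x, y))) - A t x) \<le> 2"
          using norm_triangle_ineq4[of "exp (\<i> * of_real (t * Q (x, y)))" "A t x"] A[of t] by simp
        then have "cmod ?m \<le> \<bar>C0\<bar> * 2"
          using k unfolding norm_mult norm_of_real by (intro mult_mono) auto
        then show ?thesis using W[of t] by simp
      qed
      then have "cmod ?m * cmod (f y) \<le> (W t + 2 * \<bar>C0\<bar>) * cmod (f y)" if "y \<in> ?S"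
        using that by (intro mult_right_mono) auto
      moreover have "exp (\<i> * of_real (t * Q (x, y))) * \<phi> y - A t x * \<phi> y
          = indicator ?S y *\<^sub>R (?m * f y)"
        by (simp add: \<phi>_def algebra_simps)
      moreover have "0 \<le> (W t + 2 * \<bar>C0\<bar>) * cmod (f y)"
        using W[of t] by (intro mult_nonneg_nonneg) auto
      ultimately show "cmod (exp (\<i> * of_real (t * Q (x, y))) * \<phi> y - A t x * \<phi> y)
          \<le> (W t + 2 * \<bar>C0\<bar>) * cmod (f y)"
        by (cases "y \<in> ?S") (auto simp: norm_mult)
    qed
    also have "\<dots> = (W t + 2 * \<bar>C0\<bar>) * N" by (simp add: N_def)
    finally have 1: "cmod (truncated_op (?\<kappa> t) \<epsilon> f x - A t x * truncated_op (?\<kappa> 0) \<epsilon> f x)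
        \<le> (W t + 2 * \<bar>C0\<bar>) * N" .
    have "cmod (truncated_op (?\<kappa> 0) \<epsilon> f x) \<le> cmod (pv_op (?\<kappa> 0) f x) + 1"
      using near_pv[OF \<epsilon>] norm_triangle_ineq2[of "truncated_op (?\<kappa> 0) \<epsilon> f x" "pv_op (?\<kappa> 0) f x"]
      by (simp add: dist_norm)
    then have 2: "cmod (A t x * truncated_op (?\<kappa> 0) \<epsilon> f x) \<le> 1 * (cmod (pv_op (?\<kappa> 0) f x) + 1)"
      unfolding norm_mult using A by (intro mult_mono) auto
    have "cmod (truncated_op (?\<kappa> t) \<epsilon> f x)
        \<le> (W t + 2 * \<bar>C0\<bar>) * N + (cmod (pv_op (?\<kappa> 0) f x) + 1)"
      using 1 2 norm_triangle_ineq2[of "truncated_op (?\<kappa> t) \<epsilon> f x" "A t x * truncated_op (?\<kappa> 0) \<epsilon> f x"]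
      by simp
    also have "\<dots> \<le> (W t + 2 * \<bar>C0\<bar> * W t) * N + (cmod (pv_op (?\<kappa> 0) f x) + 1) * W t"
      using W[of t] N mult_left_mono[OF W[of t], of "2 * \<bar>C0\<bar>"]
        mult_left_mono[OF W[of t], of "cmod (pv_op (?\<kappa> 0) f x) + 1"]
      by (intro add_mono mult_right_mono) auto
    also have "\<dots> = G * W t" by (simp add: G_def algebra_simps)
    finally show ?thesis .
  qed
  with \<epsilon>0 show ?thesis unfolding dominated_truncations_def by blast
qed

section \<open>Submultiplicative weight and induction on the power of the phase\<close>

text \<open>After division by \<open>a + b\<close> both summands lie in \<open>[0, 1]\<close>, where
  \<open>x \<le> x powr s\<close>.\<close>

lemma powr_add_le:
  fixes a b s :: real
  assumes "0 \<le> a" "0 \<le> b" "0 < s" "s \<le> 1"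
  shows "(a + b) powr s \<le> a powr s + b powr s"
proof (cases "a + b = 0")
  case True
  then show ?thesis by simp
next
  case False
  then have ab: "0 < a + b" using assms by linarith
  have le: "x \<le> x powr s" if "0 \<le> x" "x \<le> 1" for x :: real
    using powr_mono'[of s 1 x] that assms by (cases "x = 0") auto
  have "1 = a / (a + b) + b / (a + b)" using ab by (simp add: add_divide_distrib[symmetric])
  also have "\<dots> \<le> (a / (a + b)) powr s + (b / (a + b)) powr s"
    using assms ab by (intro add_mono le) auto
  also have "\<dots> = (a powr s + b powr s) / (a + b) powr s"
    using assms ab by (simp add: powr_divide add_divide_distrib)
  finally show ?thesis using ab by (simp add: field_simps)
qed

lemma pv_op_bounded_mono:
  assumes "pv_op_bounded p \<kappa> C" "C \<le> C'"
  shows "pv_op_bounded p \<kappa> C'"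
  using assms mult_right_mono[OF assms(2) Lp_norm_nonneg] unfolding pv_op_bounded_def
  by (meson order_trans)

theorem theorem1p6:
  fixes K Q :: "(real ^ 'n) \<times> (real ^ 'n) \<Rightarrow> real"
    and A :: "complex \<Rightarrow> real ^ 'n \<Rightarrow> complex"
    and p C0 c M s c' C1 :: real
  assumes p: "1 \<le> p"
    and K_meas: "K \<in> borel_measurable lebesgue"
    and Q_meas: "Q \<in> borel_measurable lebesgue"
    and K_size: "\<And>x y. x \<noteq> y \<Longrightarrow> \<bar>K (x, y)\<bar> \<le> C0 * dist x y powr (- real CARD('n))"
    and Q_bounded: "bounded (range Q)"
    and const_ranges: "c > 0" "M > 0" "0 < s" "s < 1"
    and near_diagonal: "\<And>z x y. dist x y < 1 \<Longrightarrow>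
          cmod (of_real (K (x, y)) * (exp (z * of_real (Q (x, y))) - A z x))
            \<le> M powr \<bar>Re z\<bar> * exp (c * \<bar>Im z\<bar> powr s)"
    and A_analytic: "\<And>x. (\<lambda>z. A z x) analytic_on UNIV"
    and A_bound: "\<And>z x. cmod (A z x) \<le> M powr \<bar>Re z\<bar>"
    and const_ranges': "c' > 0" "C1 > 0"
    and T_bounded: "\<And>t::real. pv_op_bounded p (T_kernel K (\<lambda>w. t * Q w)) (C1 * exp (c' * \<bar>t\<bar> powr s))"
  shows "\<exists>D>0. \<forall>k\<ge>1. pv_op_bounded p (H_kernel K Q k) (D ^ k)"
proof -
  \<comment> \<open>One weight has to dominate both the near-diagonal bound and the operator
    norms.\<close>
  define c0 where "c0 = max c c'"
  have c0: "0 \<le> c0" using const_ranges by (simp add: c0_def)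
  define W where "W t = exp (c0 * \<bar>t\<bar> powr s)" for t :: real
  have W1: "1 \<le> W t" for t using c0 by (simp add: W_def)
  have Wadd: "W (t + t') \<le> W t * W t'" for t t'
  proof -
    have "\<bar>t + t'\<bar> powr s \<le> (\<bar>t\<bar> + \<bar>t'\<bar>) powr s"
      using const_ranges by (intro powr_mono2) auto
    also have "\<dots> \<le> \<bar>t\<bar> powr s + \<bar>t'\<bar> powr s"
      using const_ranges by (intro powr_add_le) auto
    finally have "c0 * \<bar>t + t'\<bar> powr s \<le> c0 * (\<bar>t\<bar> powr s + \<bar>t'\<bar> powr s)"
      using c0 by (intro mult_left_mono)
    then show ?thesis by (simp add: W_def exp_add[symmetric] distrib_left)
  qed
  have W_ge: "exp (b * \<bar>t\<bar> powr s) \<le> W t" if "b \<le> c0" for b t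
    using that by (simp add: W_def mult_right_mono)
  obtain B where B: "\<And>w. \<bar>Q w\<bar> \<le> B"
    using Q_bounded by (auto simp: bounded_iff)
  obtain a \<tau> where sm: "summable (\<lambda>n. cmod (a n) * W (\<tau> n))"
    and ser: "\<And>u. \<bar>u\<bar> \<le> B \<Longrightarrow> (\<lambda>n. a n * exp (\<i> * of_real (\<tau> n * u))) sums of_real u"
    using linear_exp_series[OF const_ranges(3,4) c0, of B] unfolding W_def by metis
  define D where "D = (\<Sum>n. cmod (a n) * W (\<tau> n)) + 1"
  have "0 \<le> (\<Sum>n. cmod (a n) * W (\<tau> n))"
    using W1 by (intro suminf_nonneg sm mult_nonneg_nonneg) (auto intro: order_trans[of 0 1])
  then have D: "1 \<le> D" "(\<Sum>n. cmod (a n) * W (\<tau> n)) \<le> D" by (auto simp: D_def)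
  have T: "pv_op_bounded p (modulated_kernel K Q 0 t) (C1 * W t)" for t
  proof -
    have "modulated_kernel K Q 0 t = T_kernel K (\<lambda>w. t * Q w)"
      by (simp add: fun_eq_iff modulated_kernel_def T_kernel_def)
    then show ?thesis
      using pv_op_bounded_mono[OF T_bounded[of t]] W_ge[of c' t] const_ranges' by (simp add: c0_def)
  qed
  have dom0: "AE x in lebesgue. dominated_truncations W (modulated_kernel K Q 0) f x"
    if f: "test_function f" for f
  proof -
    have "AE x in lebesgue. pv_exists (modulated_kernel K Q 0 0) f x"
      using T f by (simp add: pv_op_bounded_def)
    with AE_lebesgue_measurable_slice[OF K_meas] AE_lebesgue_measurable_slice[OF Q_meas]
    show ?thesis
    proof eventually_elim
      case (elim x)
      show ?case
      proof (rule modulated_kernel_0_dominated[OF elim(1,2) K_size _ B test_function_integrable[OF f] W1])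
        \<comment> \<open>On the imaginary axis the factor \<open>M powr \<bar>Re z\<bar>\<close> is
          1, as \<open>M > 0\<close>.\<close>
        show "cmod (A (\<i> * of_real t) x) \<le> 1" for t
          using A_bound[of "\<i> * of_real t" x] const_ranges by simp
        fix t :: real and y assume "dist x y < 1"
        from near_diagonal[OF this, of "\<i> * of_real t"]
        have "cmod (of_real (K (x, y)) * (exp (\<i> * of_real (t * Q (x, y))) - A (\<i> * of_real t) x))
            \<le> exp (c * \<bar>t\<bar> powr s)"
          using const_ranges by (simp add: mult.assoc)
        then show "cmod (of_real (K (x, y)) * (exp (\<i> * of_real (t * Q (x, y))) - A (\<i> * of_real t) x)) \<le> W t"
          using W_ge[of c t] by (simp add: c0_def)
      qed (use elim in auto)
    qed
  qed
  have main: "(\<forall>t. pv_op_bounded p (modulated_kernel K Q k t) (C1 * D ^ k * W t)) \<and>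
      (\<forall>f. test_function f \<longrightarrow> (AE x in lebesgue. dominated_truncations W (modulated_kernel K Q k) f x))" for k
  proof (induction k)
    case 0
    then show ?case using T dom0 by simp
  next
    case (Suc k)
    have D0: "0 < D" "0 < C1 * D ^ k" using D const_ranges' by auto
    note step = modulated_kernel_bounded_Suc[OF p K_meas Q_meas K_size _ B W1 Wadd sm D(2) D0(1) ser D0(2), of k]
    show ?case
      using step(1) step(2) Suc by (simp add: mult_ac)
  qed
  \<comment> \<open>The constant \<open>C1\<close> occurs only once, and for
    \<open>k \<ge> 1\<close> it is at most the k-th power of \<open>max 1 C1\<close>.\<close>
  define D' where "D' = D * max 1 C1"
  have "D' > 0" using D by (simp add: D'_def)
  moreover have "pv_op_bounded p (H_kernel K Q k) (D' ^ k)" if k: "k \<ge> 1" for k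
  proof -
    have "modulated_kernel K Q k 0 = H_kernel K Q k"
      by (simp add: fun_eq_iff modulated_kernel_def H_kernel_def)
    moreover have "W 0 = 1" using const_ranges by (simp add: W_def)
    ultimately have "pv_op_bounded p (H_kernel K Q k) (C1 * D ^ k)"
      using main[of k] by (metis mult.right_neutral)
    moreover have "C1 * D ^ k \<le> D' ^ k"
    proof -
      have "C1 \<le> max 1 C1 ^ 1" by simp
      also have "\<dots> \<le> max 1 C1 ^ k" using k by (intro power_increasing) auto
      finally have "C1 * D ^ k \<le> max 1 C1 ^ k * D ^ k" using D by (intro mult_right_mono) auto
      then show ?thesis by (simp add: D'_def power_mult_distrib mult.commute)
    qed
    ultimately show ?thesis by (rule pv_op_bounded_mono)
  qed
  ultimately show ?thesis by blast
qed

end
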